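(* If $\mathcal{C}$ is a majority minimal clone with at most seven ternary operations (i.e. $|\mathcal{C}^{(3)}|\le 7$, the ternary projections being counted), then $\mathcal{C}^{(3)}$ is isomorphic to either $[m_1]^{(3)}$ or $[m_2]^{(3)}$.
   Context: An (abstract) clone $\mathcal{C}$ is given by a family of sets $\mathcal{C}^{(n)}$ ($n\ge 1$), distinguished elements $e_i^{(n)}\in\mathcal{C}^{(n)}$ ($1\le i\le n$, the projections), and composition maps $F^n_k:\mathcal{C}^{(n)}\times(\mathcal{C}^{(k)})^n\to\mathcal{C}^{(k)}$, $(f,g_1,\dots,g_n)\mapsto f(g_1,\dots,g_n)$ ($n,k\ge1$), satisfying $e_i^{(n)}(g_1,\dots,g_n)=g_i$, $f(e_1^{(n)},\dots,e_n^{(n)})=f$, and $f(g_1,\dots,g_n)(h_1,\dots,h_k)=f(g_1(h_1,\dots,h_k),\dots,g_n(h_1,\dots,h_k))$ for all $f\in\mathcal{C}^{(n)}$, $g_i\in\mathcal{C}^{(k)}$, $h_j\in\mathcal{C}^{(l)}$. A concrete clone (a set of finitary operations on a set, containing all projections and closed under composition) is an abstract clone in the obvious way, and every abstract clone is isomorphic to a concrete one. Elements of $\mathcal{C}^{(n)}$ are called $n$-ary operations of $\mathcal{C}$. $[f]$ denotes the (sub)clone generated by $f$. Projections are called trivial operations, all other elements of $\mathcal{C}$ nontrivial; the trivial clone is the one consisting of projections only. $\mathcal{C}$ is minimal if it has exactly two subclones: the trivial one (consisting of the projections) and $\mathcal{C}$ itself. An element $f\in\mathcal{C}^{(3)}$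 is a majority operation if it satisfies $f(x,x,y)=f(x,y,x)=f(y,x,x)=x$ identically, i.e. $f(e_1^{(2)},e_1^{(2)},e_2^{(2)})=f(e_1^{(2)},e_2^{(2)},e_1^{(2)})=f(e_2^{(2)},e_1^{(2)},e_1^{(2)})=e_1^{(2)}$ in $\mathcal{C}^{(2)}$. A majority clone is a clone $\mathcal{C}=[f]$ with $f$ a majority operation; a majority minimal clone is a majority clone that is minimal. The ternary part of $\mathcal{C}$, also denoted $\mathcal{C}^{(3)}$, is the algebra $(\mathcal{C}^{(3)};F^3_3,e_1^{(3)},e_2^{(3)},e_3^{(3)})$ with one quaternary and three nullary operations; isomorphism of ternary parts means isomorphism of such algebras. $m_1$ and $m_2$ are the majority operations on $\{1,2,3\}$ with $m_1(a,b,c)=1$ and $m_2(a,b,c)=a$ whenever $a,b,c$ are pairwise distinct; $[m_1]$, $[m_2]$ are the clones on $\{1,2,3\}$ they generate. *)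

theory Defs
  imports Main "HOL-Library.FuncSet"
begin

text \<open>
  \<open>composition C n k f [g\<^sub>1, \<dots>, g\<^sub>n]\<close> is the composition \<open>f(g\<^sub>1, \<dots>, g\<^sub>n)\<close> of the \<open>n\<close>-ary \<open>f\<close> with the
  \<open>k\<close>-ary \<open>g\<^sub>i\<close>, and \<open>proj C n i\<close> is the \<open>i\<close>-th \<open>n\<close>-ary projection, \<open>1 \<le> i \<le> n\<close>. The sets
  \<open>ops C n\<close> live in one type but need not be disjoint, so arities are always passed explicitly.
\<close>

record 'a clone =
  ops :: "nat \<Rightarrow> 'a set"
  proj :: "nat \<Rightarrow> nat \<Rightarrow> 'a"
  composition :: "nat \<Rightarrow> nat \<Rightarrow> 'a \<Rightarrow> 'a list \<Rightarrow> 'a"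

text \<open>
  Arities start at 1. The convention \<open>ops C 0 = {}\<close> makes a family indexed by the positive integers
  correspond to exactly one function on \<^typ>\<open>nat\<close>; it also forces \<open>n, k, l \<ge> 1\<close> in the axioms below.
\<close>

locale abstract_clone =
  fixes C :: "'a clone"
  assumes ops_0: "ops C 0 = {}"
    and proj_closed: "1 \<le> i \<Longrightarrow> i \<le> n \<Longrightarrow> proj C n i \<in> ops C n"
    and comp_closed:
      "f \<in> ops C n \<Longrightarrow> length gs = n \<Longrightarrow> set gs \<subseteq> ops C k \<Longrightarrow> composition C n k f gs \<in> ops C k"
    and comp_proj_left:
      "1 \<le> i \<Longrightarrow> i \<le> n \<Longrightarrow> length gs = n \<Longrightarrow> set gs \<subseteq> ops C k \<Longrightarrow>
        composition C n k (proj C n i) gs = gs ! (i - 1)"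
    and comp_proj_right:
      "f \<in> ops C n \<Longrightarrow> composition C n n f (map (proj C n) [1..<Suc n]) = f"
    and comp_assoc:
      "f \<in> ops C n \<Longrightarrow> length gs = n \<Longrightarrow> set gs \<subseteq> ops C k \<Longrightarrow>
        length hs = k \<Longrightarrow> set hs \<subseteq> ops C l \<Longrightarrow>
        composition C k l (composition C n k f gs) hs = composition C n l f (map (\<lambda>g. composition C k l g hs) gs)"

text \<open>A subclone is given by its family of sets; projections and composition are inherited.\<close>

definition subclone :: "'a clone \<Rightarrow> (nat \<Rightarrow> 'a set) \<Rightarrow> bool" where
  "subclone C D \<longleftrightarrow>
     (\<forall>n. D n \<subseteq> ops C n) \<and>
     (\<forall>n i. 1 \<le> i \<and> i \<le> n \<longrightarrow> proj C n i \<in> D n) \<and>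
     (\<forall>n k f gs. f \<in> D n \<and> length gs = n \<and> set gs \<subseteq> D k \<longrightarrow> composition C n k f gs \<in> D k)"

definition projections :: "'a clone \<Rightarrow> nat \<Rightarrow> 'a set" where
  "projections C n = proj C n ` {1..n}"

definition generated_clone :: "'a clone \<Rightarrow> nat \<Rightarrow> 'a \<Rightarrow> 'a clone" where
  "generated_clone C n f = C\<lparr>ops := \<lambda>k. \<Inter>{D k | D. subclone C D \<and> f \<in> D n}\<rparr>"

definition minimal_clone :: "'a clone \<Rightarrow> bool" where
  "minimal_clone C \<longleftrightarrow> {D. subclone C D} = {projections C, ops C} \<and> projections C \<noteq> ops C"

definition majority_operation :: "'a clone \<Rightarrow> 'a \<Rightarrow> bool" where
  "majority_operation C f \<longleftrightarrow> f \<in> ops C 3 \<and>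
     composition C 3 2 f [proj C 2 1, proj C 2 1, proj C 2 2] = proj C 2 1 \<and>
     composition C 3 2 f [proj C 2 1, proj C 2 2, proj C 2 1] = proj C 2 1 \<and>
     composition C 3 2 f [proj C 2 2, proj C 2 1, proj C 2 1] = proj C 2 1"

definition majority_clone :: "'a clone \<Rightarrow> bool" where
  "majority_clone C \<longleftrightarrow>
     abstract_clone C \<and> (\<exists>f. majority_operation C f \<and> C = generated_clone C 3 f)"

definition majority_minimal_clone :: "'a clone \<Rightarrow> bool" where
  "majority_minimal_clone C \<longleftrightarrow> majority_clone C \<and> minimal_clone C"

definition ternary_parts_isomorphic :: "'a clone \<Rightarrow> 'b clone \<Rightarrow> bool" where
  "ternary_parts_isomorphic C D \<longleftrightarrow>
     (\<exists>\<phi>. bij_betw \<phi> (ops C 3) (ops D 3) \<and>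
        (\<forall>f\<in>ops C 3. \<forall>g\<^sub>1\<in>ops C 3. \<forall>g\<^sub>2\<in>ops C 3. \<forall>g\<^sub>3\<in>ops C 3.
           \<phi> (composition C 3 3 f [g\<^sub>1, g\<^sub>2, g\<^sub>3]) = composition D 3 3 (\<phi> f) [\<phi> g\<^sub>1, \<phi> g\<^sub>2, \<phi> g\<^sub>3]) \<and>
        (\<forall>i\<in>{1..3}. \<phi> (proj C 3 i) = proj D 3 i))"

text \<open>
  The clone of all finitary operations on \<open>A\<close>: an \<open>n\<close>-ary operation is a function on the lists of
  length \<open>n\<close> over \<open>A\<close>, extended by \<^term>\<open>undefined\<close> to all other lists.
\<close>

definition tuples :: "'b set \<Rightarrow> nat \<Rightarrow> 'b list set" where
  "tuples A n = {xs. length xs = n \<and> set xs \<subseteq> A}"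

definition full_clone :: "'b set \<Rightarrow> ('b list \<Rightarrow> 'b) clone" where
  "full_clone A = \<lparr>
     ops = (\<lambda>n. if n = 0 then {} else tuples A n \<rightarrow>\<^sub>E A),
     proj = (\<lambda>n i. \<lambda>xs\<in>tuples A n. xs ! (i - 1)),
     composition = (\<lambda>n k f gs. \<lambda>xs\<in>tuples A k. f (map (\<lambda>g. g xs) gs)) \<rparr>"

definition majority_extension :: "('b \<Rightarrow> 'b \<Rightarrow> 'b \<Rightarrow> 'b) \<Rightarrow> 'b \<Rightarrow> 'b \<Rightarrow> 'b \<Rightarrow> 'b" where
  "majority_extension d a b c =
     (if a = b \<or> a = c then a else if b = c then b else d a b c)"

definition m1 :: "nat list \<Rightarrow> nat" where
  "m1 = (\<lambda>xs\<in>tuples {1, 2, 3} 3. majority_extension (\<lambda>a b c. 1) (xs ! 0) (xs ! 1) (xs ! 2))"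

definition m2 :: "nat list \<Rightarrow> nat" where
  "m2 = (\<lambda>xs\<in>tuples {1, 2, 3} 3. majority_extension (\<lambda>a b c. a) (xs ! 0) (xs ! 1) (xs ! 2))"

lemma abstract_clone_full_clone: "abstract_clone (full_clone A)"
proof -
  have mem: "map (\<lambda>g. g xs) gs \<in> tuples A n"
    if "length gs = n" "set gs \<subseteq> tuples A k \<rightarrow>\<^sub>E A" "xs \<in> tuples A k" for xs :: "'a list" and gs n k
    using that by (fastforce simp: tuples_def)
  have pos: "set gs \<subseteq> tuples A k \<rightarrow>\<^sub>E A \<and> k \<noteq> 0"
    if "set gs \<subseteq> ops (full_clone A) k" "length gs = n" "n \<noteq> 0" for gs k n
    using that by (cases gs) (auto simp: full_clone_def split: if_splits)
  show ?thesis
  proof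
    fix f n and gs :: "('a list \<Rightarrow> 'a) list" and k
    assume f: "f \<in> ops (full_clone A) n" and gs: "length gs = n" "set gs \<subseteq> ops (full_clone A) k"
    then have n: "n \<noteq> 0" by (auto simp: full_clone_def)
    have p: "set gs \<subseteq> tuples A k \<rightarrow>\<^sub>E A" "k \<noteq> 0" using pos[OF gs(2,1) n] by auto
    from f n have "f \<in> tuples A n \<rightarrow>\<^sub>E A" by (simp add: full_clone_def)
    then have "f (map (\<lambda>g. g xs) gs) \<in> A" if "xs \<in> tuples A k" for xs
      using mem[OF gs(1) p(1) that] by (rule PiE_mem)
    then show "composition (full_clone A) n k f gs \<in> ops (full_clone A) k"
      using p(2) by (simp add: full_clone_def)
    fix hs :: "('a list \<Rightarrow> 'a) list" and l
    assume hs: "length hs = k" "set hs \<subseteq> ops (full_clone A) l"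
    have q: "set hs \<subseteq> tuples A l \<rightarrow>\<^sub>E A" using pos[OF hs(2,1) p(2)] by auto
    show "composition (full_clone A) k l (composition (full_clone A) n k f gs) hs =
      composition (full_clone A) n l f (map (\<lambda>g. composition (full_clone A) k l g hs) gs)"
      using mem[OF hs(1) q] by (simp add: full_clone_def comp_def cong: restrict_cong)
  next
    fix i n and gs :: "('a list \<Rightarrow> 'a) list" and k
    assume i: "1 \<le> i" "i \<le> n" and gs: "length gs = n" "set gs \<subseteq> ops (full_clone A) k"
    then have n: "n \<noteq> 0" by simp
    have p: "set gs \<subseteq> tuples A k \<rightarrow>\<^sub>E A" using pos[OF gs(2,1) n] by auto
    have "gs ! (i - 1) \<in> tuples A k \<rightarrow>\<^sub>E A" using p gs(1) i by (simp add: subset_iff)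
    then have "restrict (gs ! (i - 1)) (tuples A k) = gs ! (i - 1)" by (rule PiE_restrict)
    then show "composition (full_clone A) n k (proj (full_clone A) n i) gs = gs ! (i - 1)"
      using mem[OF gs(1) p] i gs(1) by (simp add: full_clone_def cong: restrict_cong)
  next
    fix f n
    assume f: "f \<in> ops (full_clone A) n"
    then have "f \<in> tuples A n \<rightarrow>\<^sub>E A" by (simp add: full_clone_def split: if_splits)
    then have r: "restrict f (tuples A n) = f" by (rule PiE_restrict)
    have "map (\<lambda>g. g xs) (map (proj (full_clone A) n) [1..<Suc n]) = xs"
      if "xs \<in> tuples A n" for xs
      using that by (intro nth_equalityI) (simp_all add: full_clone_def tuples_def del: upt_Suc)
    then have "composition (full_clone A) n n f (map (proj (full_clone A) n) [1..<Suc n]) =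
        restrict f (tuples A n)"
      unfolding full_clone_def clone.simps by (intro restrict_ext) simp
    with r show "composition (full_clone A) n n f (map (proj (full_clone A) n) [1..<Suc n]) = f"
      by simp
  qed (auto simp: full_clone_def tuples_def)
qed

lemma subclone_generated_clone:
  assumes "abstract_clone C" "f \<in> ops C n"
  shows "subclone C (ops (generated_clone C n f))" "f \<in> ops (generated_clone C n f) n"
proof -
  interpret abstract_clone C by fact
  have "subclone C (ops C)" by (auto simp: subclone_def proj_closed comp_closed)
  with assms(2) have sub: "ops (generated_clone C n f) k \<subseteq> ops C k" for k
    by (auto simp: generated_clone_def)
  show "f \<in> ops (generated_clone C n f) n" by (auto simp: generated_clone_def)
  show "subclone C (ops (generated_clone C n f))"
    unfolding subclone_def
  proof (intro conjI allI impI sub)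
    fix m i :: nat assume "1 \<le> i \<and> i \<le> m"
    then show "proj C m i \<in> ops (generated_clone C n f) m"
      by (auto simp: generated_clone_def subclone_def)
  next
    fix m k :: nat and g gs
    assume a: "g \<in> ops (generated_clone C n f) m \<and> length gs = m \<and>
      set gs \<subseteq> ops (generated_clone C n f) k"
    have "composition C m k g gs \<in> D k" if D: "subclone C D" "f \<in> D n" for D
    proof -
      have "g \<in> D m" "set gs \<subseteq> D k" using a D by (auto simp: generated_clone_def)
      with D(1) a show ?thesis by (auto simp: subclone_def)
    qed
    then show "composition C m k g gs \<in> ops (generated_clone C n f) k"
      by (auto simp: generated_clone_def)
  qed
qed

lemma majority_operation_m1: "majority_operation (full_clone {1, 2, 3}) m1"
  and majority_operation_m2: "majority_operation (full_clone {1, 2, 3}) m2"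
  by (auto simp: majority_operation_def full_clone_def m1_def m2_def majority_extension_def
      tuples_def subset_iff all_set_conv_all_nth intro!: restrict_ext)

end

theory Submission
  imports Defs
begin

text \<open>
  The clone acts on the two-element set of its binary projections, and there \<open>[f]\<close> induces only the
  ternary projections and the majority operation. By minimality every nontrivial ternary operation is
  therefore a majority operation, so there are at most four of them. Permuting variables makes the
  symmetric group act on this set \<open>M\<close>, and the ternary part is the free algebra on \<open>x, y, z\<close>, so every
  equation in it may be substituted into.

  Suppose that all of \<open>M\<close> is cyclic. If \<open>f \<in> M\<close> is not symmetric, let \<open>f' = f(y, x, z)\<close> and
  \<open>g = f(x, f, f')\<close>; substitutions show that \<open>f, f', g, g'\<close> are distinct and that \<open>f(x, g, g')\<close> can be
  none of them. So some element is symmetric, and the symmetric ones form a semigroup under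
  \<open>t(x, y, u)\<close>; an idempotent \<open>e\<close> satisfies \<open>e(x, y, e) = e\<close>, and \<open>{x, y, z, e}\<close> is closed as in
  \<open>[m\<^sub>1]\<close>.

  Otherwise \<open>M\<close> contains an orbit of size three, generated by some \<open>f = f(x | y, z)\<close> that is symmetric in
  \<open>y, z\<close>. If there is nothing else, invariance under transpositions and a few substitutions
  determine \<open>f\<close>, as in \<open>[m\<^sub>2]\<close>. A fourth element \<open>s\<close> would be symmetric with
  \<open>s(x, y, s) = f(z | x, y)\<close>, which again forces \<open>f\<close> to behave as in \<open>[m\<^sub>2]\<close>; but then \<open>f\<close> does
  not generate \<open>s\<close>.
\<close>

section \<open>Operations preserving a set, and ternary parts read off from multiplication
  tables\<close>

abbreviation ternary_comp :: "'a clone \<Rightarrow> 'a \<Rightarrow> 'a \<Rightarrow> 'a \<Rightarrow> 'a \<Rightarrow> 'a" where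
  "ternary_comp C t a b c \<equiv> composition C 3 3 t [a, b, c]"

lemma length_3_conv: "length xs = 3 \<longleftrightarrow> (\<exists>a b c. xs = [a, b, c])"
  by (auto simp: numeral_3_eq_3 length_Suc_conv)

context abstract_clone
begin

lemma comp_assoc_3:
  assumes "t \<in> ops C 3" "a \<in> ops C k" "b \<in> ops C k" "c \<in> ops C k" "length hs = k" "set hs \<subseteq> ops C l"
  shows "composition C k l (composition C 3 k t [a, b, c]) hs =
    composition C 3 l t [composition C k l a hs, composition C k l b hs, composition C k l c hs]"
  using comp_assoc[of t 3 "[a, b, c]" k hs l] assms by simp

lemma comp_3_closed:
  "t \<in> ops C 3 \<Longrightarrow> a \<in> ops C k \<Longrightarrow> b \<in> ops C k \<Longrightarrow> c \<in> ops C k \<Longrightarrow>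
    composition C 3 k t [a, b, c] \<in> ops C k"
  by (rule comp_closed) auto

lemma comp_3_proj:
  assumes "a \<in> ops C k" "b \<in> ops C k" "c \<in> ops C k"
  shows "composition C 3 k (proj C 3 (Suc 0)) [a, b, c] = a"
    "composition C 3 k (proj C 3 2) [a, b, c] = b"
    "composition C 3 k (proj C 3 3) [a, b, c] = c"
  using assms comp_proj_left[of _ 3 "[a, b, c]" k] by auto

lemma comp_2_proj:
  assumes "a \<in> ops C k" "b \<in> ops C k"
  shows "composition C 2 k (proj C 2 (Suc 0)) [a, b] = a"
    "composition C 2 k (proj C 2 2) [a, b] = b"
  using assms comp_proj_left[of _ 2 "[a, b]" k] by auto

lemma comp_3_proj_right:
  assumes "t \<in> ops C 3"
  shows "ternary_comp C t (proj C 3 (Suc 0)) (proj C 3 2) (proj C 3 3) = t"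
proof -
  have "[Suc 0..<Suc 3] = [Suc 0, 2, 3]" by (simp add: upt_rec)
  then show ?thesis using comp_proj_right[OF assms] by (simp del: upt_Suc)
qed

lemma proj_3_closed: "i \<in> {1..3} \<Longrightarrow> proj C 3 i \<in> ops C 3"
  by (auto intro: proj_closed)

text \<open>The operations that preserve \<open>S\<close> form a subclone, so all of
  \<open>[f]\<close> preserves \<open>S\<close> once \<open>f\<close> does. A \<open>k\<close>-ary
  member of \<open>[f]\<close> is its own value at the projections, which lie in
  \<open>S\<close>.\<close>

lemma generated_ops_subset:
  assumes f: "f \<in> ops C n" and S: "S \<subseteq> ops C k" "\<And>i. i \<in> {1..k} \<Longrightarrow> proj C k i \<in> S"
    and closed: "\<And>hs. length hs = n \<Longrightarrow> set hs \<subseteq> S \<Longrightarrow> composition C n k f hs \<in> S"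
  shows "ops (generated_clone C n f) k \<subseteq> S"
proof
  fix t assume t: "t \<in> ops (generated_clone C n f) k"
  define D where
    "D m = {u \<in> ops C m. \<forall>hs. length hs = m \<and> set hs \<subseteq> S \<longrightarrow> composition C m k u hs \<in> S}" for m
  have "subclone C D"
    unfolding subclone_def
  proof (intro conjI allI impI)
    fix m i :: nat assume i: "1 \<le> i \<and> i \<le> m"
    have "composition C m k (proj C m i) hs \<in> S" if "length hs = m" "set hs \<subseteq> S" for hs
    proof -
      have "composition C m k (proj C m i) hs = hs ! (i - 1)"
        using i that S(1) by (intro comp_proj_left) auto
      then show ?thesis using i that by (auto simp: subset_iff)
    qed
    then show "proj C m i \<in> D m" using i by (simp add: D_def proj_closed)
  next
    fix m l :: nat and u gs assume a: "u \<in> D m \<and> length gs = m \<and> set gs \<subseteq> D l"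
    have gs: "set gs \<subseteq> ops C l" using a by (auto simp: D_def)
    have "composition C l k (composition C m l u gs) hs \<in> S"
      if hs: "length hs = l" "set hs \<subseteq> S" for hs
    proof -
      have "composition C l k (composition C m l u gs) hs =
          composition C m k u (map (\<lambda>g. composition C l k g hs) gs)"
        using a gs hs S(1) by (intro comp_assoc) (auto simp: D_def)
      moreover have "set (map (\<lambda>g. composition C l k g hs) gs) \<subseteq> S"
        using a hs by (auto simp: D_def)
      ultimately show ?thesis using a by (auto simp: D_def)
    qed
    then show "composition C m l u gs \<in> D l" using a gs by (auto simp: D_def comp_closed)
  qed (auto simp: D_def)
  moreover have "f \<in> D n" using f closed by (simp add: D_def)
  ultimately have "t \<in> D k" using t by (auto simp: generated_clone_def)
  moreover have "set (map (proj C k) [1..<Suc k]) \<subseteq> S" using S(2) by auto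
  ultimately have "composition C k k t (map (proj C k) [1..<Suc k]) \<in> S" "t \<in> ops C k"
    by (auto simp: D_def simp del: upt_Suc set_map)
  then show "t \<in> S" using comp_proj_right[of t k] by (simp del: upt_Suc)
qed

text \<open>\<open>L\<close> is a set of labels with evaluation \<open>v\<close>, and
  \<open>\<mu>\<close> is the table of \<open>f\<close> on labels. The hypothesis
  \<open>gen\<close>, by which the labels of the projections generate \<open>L\<close>, serves as an
  induction rule.\<close>

lemma generated_ternary_part:
  assumes f: "f \<in> ops C 3"
    and p: "\<And>i. i \<in> {1..3} \<Longrightarrow> p i \<in> L \<and> v (p i) = proj C 3 i"
    and table: "\<And>a b c. a \<in> L \<Longrightarrow> b \<in> L \<Longrightarrow> c \<in> L \<Longrightarrow>
      \<mu> a b c \<in> L \<and> ternary_comp C f (v a) (v b) (v c) = v (\<mu> a b c)"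
    and gen: "\<And>S. \<lbrakk>\<And>i. i \<in> {1..3} \<Longrightarrow> p i \<in> S;
      \<And>a b c. a \<in> S \<Longrightarrow> b \<in> S \<Longrightarrow> c \<in> S \<Longrightarrow> \<mu> a b c \<in> S\<rbrakk> \<Longrightarrow> L \<subseteq> S"
  shows "ops (generated_clone C 3 f) 3 = v ` L" "v ` L \<subseteq> ops C 3"
proof -
  let ?G = "ops (generated_clone C 3 f)"
  have sub: "subclone C ?G" "f \<in> ?G 3"
    using abstract_clone_axioms f by (rule subclone_generated_clone)+
  have "L \<subseteq> {l \<in> L. v l \<in> ?G 3}"
  proof (rule gen)
    fix i :: nat assume "i \<in> {1..3}"
    then show "p i \<in> {l \<in> L. v l \<in> ?G 3}" using p sub(1) by (auto simp: subclone_def)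
  next
    fix a b c assume *: "a \<in> {l \<in> L. v l \<in> ?G 3}" "b \<in> {l \<in> L. v l \<in> ?G 3}"
      "c \<in> {l \<in> L. v l \<in> ?G 3}"
    have "ternary_comp C f (v a) (v b) (v c) \<in> ?G 3"
      using sub * unfolding subclone_def
      by (metis (no_types, lifting) empty_subsetI insert_subset length_3_conv list.set(1) list.set(2)
          mem_Collect_eq)
    then show "\<mu> a b c \<in> {l \<in> L. v l \<in> ?G 3}" using table * by simp
  qed
  then have sup: "v ` L \<subseteq> ?G 3" by auto
  moreover have "?G 3 \<subseteq> ops C 3" using sub(1) by (auto simp: subclone_def)
  ultimately show L: "v ` L \<subseteq> ops C 3" by blast
  have "?G 3 \<subseteq> v ` L"
    using f L
  proof (rule generated_ops_subset)
    show "proj C 3 i \<in> v ` L" if "i \<in> {1..3}" for i using p[OF that] by (metis imageI)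
    show "composition C 3 3 f hs \<in> v ` L" if "length hs = 3" "set hs \<subseteq> v ` L" for hs
    proof -
      obtain a b c where "hs = [v a, v b, v c]" "a \<in> L" "b \<in> L" "c \<in> L"
        using \<open>length hs = 3\<close> \<open>set hs \<subseteq> v ` L\<close> by (auto simp: length_3_conv)
      then show ?thesis using table by simp
    qed
  qed
  with sup show "?G 3 = v ` L" by blast
qed

end

text \<open>The table \<open>\<mu>\<close> describes only \<open>f\<close> and \<open>g\<close>.
  That the other ternary operations also act alike on both sides follows by induction over
  \<open>L\<close>, because substitution distributes over \<open>f\<close> and \<open>g\<close> by
  associativity.\<close>

lemma ternary_parts_isomorphicI:
  assumes C: "abstract_clone C" "f \<in> ops C 3" and D: "abstract_clone D" "g \<in> ops D 3"
    and inj: "inj_on v L" "inj_on w L"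
    and p: "\<And>i. i \<in> {1..3} \<Longrightarrow> p i \<in> L \<and> v (p i) = proj C 3 i \<and> w (p i) = proj D 3 i"
    and table: "\<And>a b c. a \<in> L \<Longrightarrow> b \<in> L \<Longrightarrow> c \<in> L \<Longrightarrow> \<mu> a b c \<in> L \<and>
      ternary_comp C f (v a) (v b) (v c) = v (\<mu> a b c) \<and>
      ternary_comp D g (w a) (w b) (w c) = w (\<mu> a b c)"
    and gen: "\<And>S. \<lbrakk>\<And>i. i \<in> {1..3} \<Longrightarrow> p i \<in> S;
      \<And>a b c. a \<in> S \<Longrightarrow> b \<in> S \<Longrightarrow> c \<in> S \<Longrightarrow> \<mu> a b c \<in> S\<rbrakk> \<Longrightarrow> L \<subseteq> S"
  shows "ternary_parts_isomorphic (generated_clone C 3 f) (generated_clone D 3 g)"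
proof -
  interpret C: abstract_clone C by fact
  interpret D: abstract_clone D by fact
  have C3: "ops (generated_clone C 3 f) 3 = v ` L" "v ` L \<subseteq> ops C 3"
    using C.generated_ternary_part[of f p L v \<mu>] C(2) p table gen by blast+
  have D3: "ops (generated_clone D 3 g) 3 = w ` L" "w ` L \<subseteq> ops D 3"
    using D.generated_ternary_part[of g p L w \<mu>] D(2) p table gen by blast+
  let ?P = "\<lambda>l. \<forall>a\<in>L. \<forall>b\<in>L. \<forall>c\<in>L. \<exists>m\<in>L. ternary_comp C (v l) (v a) (v b) (v c) = v m \<and>
    ternary_comp D (w l) (w a) (w b) (w c) = w m"
  have "L \<subseteq> {l \<in> L. ?P l}"
  proof (rule gen)
    fix i :: nat assume i: "i \<in> {1..3}"
    then consider "i = Suc 0" | "i = 2" | "i = 3" by force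
    then have "?P (p i)"
      using p[OF i] C3(2) D3(2) by cases (auto simp: C.comp_3_proj D.comp_3_proj subset_iff)
    then show "p i \<in> {l \<in> L. ?P l}" using p[OF i] by simp
  next
    fix l1 l2 l3 assume l: "l1 \<in> {l \<in> L. ?P l}" "l2 \<in> {l \<in> L. ?P l}" "l3 \<in> {l \<in> L. ?P l}"
    have "\<exists>m\<in>L. ternary_comp C (v (\<mu> l1 l2 l3)) (v a) (v b) (v c) = v m \<and>
      ternary_comp D (w (\<mu> l1 l2 l3)) (w a) (w b) (w c) = w m"
      if abc: "a \<in> L" "b \<in> L" "c \<in> L" for a b c
    proof -
      obtain m1 where m1: "m1 \<in> L" "ternary_comp C (v l1) (v a) (v b) (v c) = v m1"
        "ternary_comp D (w l1) (w a) (w b) (w c) = w m1" using l(1) abc by blast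
      obtain m2 where m2: "m2 \<in> L" "ternary_comp C (v l2) (v a) (v b) (v c) = v m2"
        "ternary_comp D (w l2) (w a) (w b) (w c) = w m2" using l(2) abc by blast
      obtain m3 where m3: "m3 \<in> L" "ternary_comp C (v l3) (v a) (v b) (v c) = v m3"
        "ternary_comp D (w l3) (w a) (w b) (w c) = w m3" using l(3) abc by blast
      have vw: "v l1 \<in> ops C 3" "v l2 \<in> ops C 3" "v l3 \<in> ops C 3" "w l1 \<in> ops D 3"
        "w l2 \<in> ops D 3" "w l3 \<in> ops D 3" "set [v a, v b, v c] \<subseteq> ops C 3"
        "set [w a, w b, w c] \<subseteq> ops D 3"
        using C3(2) D3(2) l abc by auto
      have t: "v (\<mu> l1 l2 l3) = ternary_comp C f (v l1) (v l2) (v l3)"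
        "w (\<mu> l1 l2 l3) = ternary_comp D g (w l1) (w l2) (w l3)"
        using table l by auto
      have "ternary_comp C (v (\<mu> l1 l2 l3)) (v a) (v b) (v c) = v (\<mu> m1 m2 m3)"
        "ternary_comp D (w (\<mu> l1 l2 l3)) (w a) (w b) (w c) = w (\<mu> m1 m2 m3)"
        unfolding t
        using C.comp_assoc_3[OF C(2) vw(1-3) _ vw(7)] D.comp_assoc_3[OF D(2) vw(4-6) _ vw(8)]
        by (simp_all add: m1 m2 m3 table)
      then show ?thesis using table m1(1) m2(1) m3(1) by blast
    qed
    then show "\<mu> l1 l2 l3 \<in> {l \<in> L. ?P l}" using table l by blast
  qed
  then have comp: "\<exists>m\<in>L. ternary_comp C (v l) (v a) (v b) (v c) = v m \<and>
    ternary_comp D (w l) (w a) (w b) (w c) = w m"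
    if "l \<in> L" "a \<in> L" "b \<in> L" "c \<in> L" for l a b c
    using that by blast
  define \<phi> where "\<phi> = w \<circ> inv_into L v"
  have \<phi>: "\<phi> (v l) = w l" if "l \<in> L" for l
    using that inj(1) by (simp add: \<phi>_def)
  have "bij_betw \<phi> (v ` L) (w ` L)"
    unfolding \<phi>_def using inj
    by (intro bij_betw_trans[of _ _ L] bij_betw_inv_into) (auto simp: bij_betw_def)
  moreover have "\<phi> (ternary_comp C t a b c) = ternary_comp D (\<phi> t) (\<phi> a) (\<phi> b) (\<phi> c)"
    if "t \<in> v ` L" "a \<in> v ` L" "b \<in> v ` L" "c \<in> v ` L" for t a b c
    using that comp by (force simp: \<phi>)
  moreover have "\<phi> (proj C 3 i) = proj D 3 i" if "i \<in> {1..3}" for i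
    using p[OF that] \<phi>[of "p i"] by simp
  moreover have "composition (generated_clone C 3 f) = composition C"
    "composition (generated_clone D 3 g) = composition D"
    "proj (generated_clone C 3 f) = proj C" "proj (generated_clone D 3 g) = proj D"
    by (simp_all add: generated_clone_def)
  ultimately show ?thesis
    unfolding ternary_parts_isomorphic_def C3 D3 by (intro exI[of _ \<phi>]) simp
qed

section \<open>The ternary operations generated by \<open>[m\<^sub>1]\<close> and \<open>[m\<^sub>2]\<close>\<close>

text \<open>The laws common to the symmetric case and to the pointwise action of \<open>m1\<close>.
  They suffice to compute \<open>f\<close> on three elements together with their value.\<close>

locale m1_algebra =
  fixes X :: "'a set" and f :: "'a \<Rightarrow> 'a \<Rightarrow> 'a \<Rightarrow> 'a"
  assumes closed: "a \<in> X \<Longrightarrow> b \<in> X \<Longrightarrow> c \<in> X \<Longrightarrow> f a b c \<in> X"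
    and majority: "a \<in> X \<Longrightarrow> b \<in> X \<Longrightarrow> f a a b = a" "a \<in> X \<Longrightarrow> b \<in> X \<Longrightarrow> f a b a = a"
      "a \<in> X \<Longrightarrow> b \<in> X \<Longrightarrow> f b a a = a"
    and symmetric: "a \<in> X \<Longrightarrow> b \<in> X \<Longrightarrow> c \<in> X \<Longrightarrow> f b a c = f a b c"
      "a \<in> X \<Longrightarrow> b \<in> X \<Longrightarrow> c \<in> X \<Longrightarrow> f a c b = f a b c"
    and absorb: "a \<in> X \<Longrightarrow> b \<in> X \<Longrightarrow> c \<in> X \<Longrightarrow> f a b (f a b c) = f a b c"

text \<open>The projections are labelled \<open>1, 2, 3\<close>, and \<open>0\<close> stands for \<open>f(a, b, c)\<close>.\<close>

definition m1_term :: "('a \<Rightarrow> 'a \<Rightarrow> 'a \<Rightarrow> 'a) \<Rightarrow> 'a \<Rightarrow> 'a \<Rightarrow> 'a \<Rightarrow> nat \<Rightarrow> 'a" where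
  "m1_term f a b c i = (if i = 1 then a else if i = 2 then b else if i = 3 then c else f a b c)"

lemma (in m1_algebra) m1_table:
  assumes abc: "a \<in> X" "b \<in> X" "c \<in> X"
    and ijk: "i \<in> {0, 1, 2, 3}" "j \<in> {0, 1, 2, 3}" "k \<in> {0, 1, 2, 3}"
  shows "f (m1_term f a b c i) (m1_term f a b c j) (m1_term f a b c k) =
    m1_term f a b c (majority_extension (\<lambda>_ _ _. 0) i j k)"
proof -
  have s: "f a b c \<in> X" using abc by (rule closed)
  have perm: "f b a c = f a b c" "f a c b = f a b c" "f b c a = f a b c" "f c a b = f a b c"
    "f c b a = f a b c"
    using symmetric abc by metis+
  have absorb': "f p q (f p q r) = f p q r" "f p (f p q r) q = f p q r" "f (f p q r) p q = f p q r"
    if "p \<in> X" "q \<in> X" "r \<in> X" for p q r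
    using symmetric absorb closed that by metis+
  note ab = absorb'[OF abc] absorb'[OF abc(2,1,3)] absorb'[OF abc(1,3,2)] absorb'[OF abc(2,3,1)]
    absorb'[OF abc(3,1,2)] absorb'[OF abc(3,2,1)]
  show ?thesis
    using ijk
    by (elim insertE emptyE; simp add: m1_term_def majority_extension_def majority abc s perm
        ab[unfolded perm])
qed

text \<open>
  Here \<open>f a b c\<close> is thought of as \<open>f(a | b, c)\<close>, an operation that prefers its first argument when
  all three differ. The digits in the names below are the indices of the arguments, where the \<open>i\<close>-th
  variable and \<open>f\<close> with the \<open>i\<close>-th variable in the first position both have index \<open>i\<close>.
\<close>

locale m2_algebra =
  fixes X :: "'a set" and f :: "'a \<Rightarrow> 'a \<Rightarrow> 'a \<Rightarrow> 'a"
  assumes closed: "a \<in> X \<Longrightarrow> b \<in> X \<Longrightarrow> c \<in> X \<Longrightarrow> f a b c \<in> X"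
    and majority: "a \<in> X \<Longrightarrow> b \<in> X \<Longrightarrow> f a a b = a" "a \<in> X \<Longrightarrow> b \<in> X \<Longrightarrow> f a b a = a"
      "a \<in> X \<Longrightarrow> b \<in> X \<Longrightarrow> f b a a = a"
    and symmetric: "a \<in> X \<Longrightarrow> b \<in> X \<Longrightarrow> c \<in> X \<Longrightarrow> f a c b = f a b c"
    and absorb_121: "a \<in> X \<Longrightarrow> b \<in> X \<Longrightarrow> c \<in> X \<Longrightarrow> f a b (f a b c) = f a b c"
    and absorb_123: "a \<in> X \<Longrightarrow> b \<in> X \<Longrightarrow> c \<in> X \<Longrightarrow> f a b (f c a b) = f a b c"
      "a \<in> X \<Longrightarrow> b \<in> X \<Longrightarrow> c \<in> X \<Longrightarrow> f a (f b a c) (f c a b) = f a b c"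
      "a \<in> X \<Longrightarrow> b \<in> X \<Longrightarrow> c \<in> X \<Longrightarrow> f (f a b c) b c = f a b c"
      "a \<in> X \<Longrightarrow> b \<in> X \<Longrightarrow> c \<in> X \<Longrightarrow> f (f a b c) (f b a c) (f c a b) = f a b c"
begin

text \<open>With \<open>f b a c\<close> for \<open>b\<close> and \<open>b\<close> for
  \<open>c\<close>, the left side of \<open>absorb_123(1)\<close> has two equal arguments by
  \<open>absorb_121\<close>. The second equation is the first with \<open>f a b c\<close> in place
  of \<open>a\<close>.\<close>

lemma absorb_122:
  assumes "a \<in> X" "b \<in> X" "c \<in> X"
  shows "f a b (f b a c) = f b a c" "f (f a b c) b (f b a c) = f b a c"
proof -
  have *: "f a b (f b a c) = f b a c" if "a \<in> X" "b \<in> X" "c \<in> X" for a b c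
    using absorb_123(1)[of a "f b a c" b] absorb_121[of b a c]
      symmetric[of b "f b a c" a] symmetric[of a "f b a c" b] that
    by (simp add: closed majority)
  show "f a b (f b a c) = f b a c" by (rule *) fact+
  show "f (f a b c) b (f b a c) = f b a c"
    using *[of "f a b c" b c] absorb_123(1)[of b c a] symmetric[of b a c]
      symmetric[of b c "f a b c"] assms
    by (simp add: closed)
qed

text \<open>The first equation is \<open>absorb_121\<close> with \<open>f b a c\<close> for
  \<open>b\<close>. The other two are \<open>absorb_123(1)\<close> with \<open>f a b c\<close> in
  first position, where the inner value becomes \<open>f a b c\<close> again and majority
  applies.\<close>

lemma absorb_121':
  assumes "a \<in> X" "b \<in> X" "c \<in> X"
  shows "f a (f b a c) (f a b c) = f a b c" "f (f a b c) b a = f a b c"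
    "f (f a b c) (f b a c) a = f a b c"
proof -
  show 1: "f a (f b a c) (f a b c) = f a b c"
    using absorb_121[of a "f b a c" c] absorb_123(1)[of a c b] assms
      symmetric[of b a c] symmetric[of a b c] symmetric[of a c "f b a c"]
    by (simp add: closed)
  show "f (f a b c) b a = f a b c"
    using absorb_123(1)[of "f a b c" b a] absorb_121[of a b c] assms
      symmetric[of a b "f a b c"] by (simp add: closed majority)
  show "f (f a b c) (f b a c) a = f a b c"
    using absorb_123(1)[of "f a b c" "f b a c" a] 1 assms
      symmetric[of a "f b a c" "f a b c"] by (simp add: closed majority)
qed

lemma absorb_123':
  assumes "a \<in> X" "b \<in> X" "c \<in> X"
  shows "f (f a b c) b (f c a b) = f a b c"
  using absorb_123(1)[of "f a b c" b c] absorb_123(1)[of c b a] absorb_123(3)[of a b c]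
    symmetric[of a b c] symmetric[of c a b] symmetric[of c b "f a b c"] assms
  by (simp add: closed)

end

text \<open>
  The label \<open>(i, False)\<close> is the \<open>i\<close>-th projection, and \<open>(i, True)\<close> is \<open>f\<close> with the \<open>i\<close>-th
  variable in the first position.
\<close>

definition m2_term :: "('a \<Rightarrow> 'a \<Rightarrow> 'a \<Rightarrow> 'a) \<Rightarrow> 'a \<Rightarrow> 'a \<Rightarrow> 'a \<Rightarrow> nat \<times> bool \<Rightarrow> 'a" where
  "m2_term f a b c = (\<lambda>(i, t).
     if t then if i = 1 then f a b c else if i = 2 then f b a c else f c a b
     else if i = 1 then a else if i = 2 then b else c)"

text \<open>On indices this is the rule of \<open>m2\<close>. Three distinct labels may still share
  an index, as when a variable meets the operation that prefers it; the value then has that index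
  and flag \<open>True\<close>.\<close>

definition m2_label :: "nat \<times> bool \<Rightarrow> nat \<times> bool \<Rightarrow> nat \<times> bool \<Rightarrow> nat \<times> bool" where
  "m2_label = majority_extension
     (\<lambda>i j k. (majority_extension (\<lambda>a b c. a) (fst i) (fst j) (fst k), True))"

lemma m2_label_closed:
  "\<lbrakk>i \<in> {1, 2, 3} \<times> UNIV; j \<in> {1, 2, 3} \<times> UNIV; k \<in> {1, 2, 3} \<times> UNIV\<rbrakk> \<Longrightarrow>
    m2_label i j k \<in> {1, 2, 3} \<times> UNIV"
  by (simp add: m2_label_def majority_extension_def mem_Times_iff)

lemma (in m2_algebra) m2_table:
  assumes abc: "a \<in> X" "b \<in> X" "c \<in> X"
    and ijk: "i \<in> {1, 2, 3} \<times> UNIV" "j \<in> {1, 2, 3} \<times> UNIV" "k \<in> {1, 2, 3} \<times> UNIV"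
  shows "f (m2_term f a b c i) (m2_term f a b c j) (m2_term f a b c k) =
    m2_term f a b c (m2_label i j k)"
proof -
  have s: "f a b c \<in> X" "f b a c \<in> X" "f c a b \<in> X" using abc by (auto intro: closed)
  have perm: "f a c b = f a b c" "f b c a = f b a c" "f c b a = f c a b"
    using symmetric abc by metis+
  have ab: "f p q (f p q r) = f p q r" "f p (f q p r) (f p q r) = f p q r"
    "f (f p q r) q p = f p q r" "f (f p q r) (f q p r) p = f p q r"
    "f p q (f q p r) = f q p r" "f (f p q r) q (f q p r) = f q p r"
    "f p q (f r p q) = f p q r" "f p (f q p r) (f r p q) = f p q r" "f (f p q r) q r = f p q r"
    "f (f p q r) q (f r p q) = f p q r" "f (f p q r) (f q p r) (f r p q) = f p q r"
    if "p \<in> X" "q \<in> X" "r \<in> X" for p q r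
    using that by (simp_all add: absorb_121 absorb_122 absorb_121' absorb_123 absorb_123')
  have ab': "f p (f p q r) q = f p q r" "f p (f p q r) (f q p r) = f p q r"
    "f (f p q r) p q = f p q r" "f (f p q r) p (f q p r) = f p q r"
    "f p (f q p r) q = f q p r" "f (f p q r) (f q p r) q = f q p r"
    "f p (f r p q) q = f p q r" "f p (f r p q) (f q p r) = f p q r" "f (f p q r) r q = f p q r"
    "f (f p q r) (f r p q) q = f p q r" "f (f p q r) (f r p q) (f q p r) = f p q r"
    if "p \<in> X" "q \<in> X" "r \<in> X" for p q r
    by (subst symmetric; simp add: that ab closed)+
  note abs = ab[OF abc] ab[OF abc(2,1,3)] ab[OF abc(1,3,2)] ab[OF abc(2,3,1)]
    ab[OF abc(3,1,2)] ab[OF abc(3,2,1)] ab'[OF abc] ab'[OF abc(2,1,3)] ab'[OF abc(1,3,2)]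
    ab'[OF abc(2,3,1)] ab'[OF abc(3,1,2)] ab'[OF abc(3,2,1)]
  note simps = m2_term_def m2_label_def majority_extension_def majority abc s perm abs[unfolded perm]
  have "f (m2_term f a b c (i, p)) (m2_term f a b c (j, q)) (m2_term f a b c (k, r)) =
    m2_term f a b c (m2_label (i, p) (j, q) (k, r))"
    if "i \<in> {1, 2, 3}" "j \<in> {1, 2, 3}" "k \<in> {1, 2, 3}" for i j k p q r
    using that by (elim insertE emptyE; cases p; cases q; cases r; simp add: simps)
  then show ?thesis using ijk by (cases i; cases j; cases k) simp
qed

section \<open>Ternary parts with at most four majority operations\<close>

text \<open>Let \<open>e\<close> lie in a minimal nonempty closed subset \<open>B\<close>. The left
  multiples of \<open>e\<close> form a closed subset, hence all of \<open>B\<close>, so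
  \<open>m e b = e\<close> has a solution. The solutions form a closed subset as well, so
  \<open>e\<close> is one of them.\<close>

lemma finite_semigroup_idempotent:
  assumes "finite A" "A \<noteq> {}" and closed: "\<And>a b. a \<in> A \<Longrightarrow> b \<in> A \<Longrightarrow> m a b \<in> A"
    and assoc: "\<And>a b c. a \<in> A \<Longrightarrow> b \<in> A \<Longrightarrow> c \<in> A \<Longrightarrow> m (m a b) c = m a (m b c)"
  obtains e where "e \<in> A" "m e e = e"
proof -
  define P where "P B \<longleftrightarrow> B \<subseteq> A \<and> B \<noteq> {} \<and> (\<forall>a\<in>B. \<forall>b\<in>B. m a b \<in> B)" for B
  have "finite {B. P B}" by (rule finite_subset[of _ "Pow A"]) (use assms(1) in \<open>auto simp: P_def\<close>)
  moreover have "A \<in> {B. P B}" using assms(2) closed by (simp add: P_def)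
  ultimately obtain B where B: "P B" and min: "\<And>B'. P B' \<Longrightarrow> B' \<subseteq> B \<Longrightarrow> B' = B"
    using finite_has_minimal[of "{B. P B}"] by (metis empty_iff mem_Collect_eq)
  have sub: "b \<in> A" if "b \<in> B" for b using B that by (auto simp: P_def)
  have mult: "m b c \<in> B" if "b \<in> B" "c \<in> B" for b c using B that by (simp add: P_def)
  obtain e where e: "e \<in> B" using B by (auto simp: P_def)
  have "m e ` B = B"
  proof (rule min)
    have "m (m e b) (m e c) = m e (m b (m e c))" if "b \<in> B" "c \<in> B" for b c
      using that e by (intro assoc) (auto intro: sub mult)
    then show "P (m e ` B)" unfolding P_def using e by (auto intro: sub mult)
  qed (use e mult in blast)
  then obtain b where b: "b \<in> B" "m e b = e" using e by (metis imageE)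
  have "{b \<in> B. m e b = e} = B"
  proof (rule min)
    have "m e (m b c) = e" if "b \<in> B" "c \<in> B" "m e b = e" "m e c = e" for b c
      using that e assoc[of e b c] by (simp add: sub)
    then show "P {b \<in> B. m e b = e}" unfolding P_def using b by (auto intro: sub mult)
  qed blast
  then show thesis using that e sub by blast
qed

text \<open>
  The ternary part of a majority minimal clone: \<open>ap t a b c\<close> is \<open>t(a, b, c)\<close> and \<open>M\<close> is the set of
  majority operations. As \<open>X\<close> is freely generated by \<open>x, y, z\<close>, an equation between elements of \<open>X\<close>
  holds as an identity.
\<close>

locale minimal_ternary_part =
  fixes X M :: "'a set" and ap :: "'a \<Rightarrow> 'a \<Rightarrow> 'a \<Rightarrow> 'a \<Rightarrow> 'a" and x y z :: 'a
  assumes closed [simp]: "\<lbrakk>t \<in> X; a \<in> X; b \<in> X; c \<in> X\<rbrakk> \<Longrightarrow> ap t a b c \<in> X"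
    and assoc: "\<lbrakk>t \<in> X; a \<in> X; b \<in> X; c \<in> X; p \<in> X; q \<in> X; r \<in> X\<rbrakk> \<Longrightarrow>
      ap (ap t a b c) p q r = ap t (ap a p q r) (ap b p q r) (ap c p q r)"
    and proj [simp]: "\<lbrakk>a \<in> X; b \<in> X; c \<in> X\<rbrakk> \<Longrightarrow> ap x a b c = a"
      "\<lbrakk>a \<in> X; b \<in> X; c \<in> X\<rbrakk> \<Longrightarrow> ap y a b c = b"
      "\<lbrakk>a \<in> X; b \<in> X; c \<in> X\<rbrakk> \<Longrightarrow> ap z a b c = c"
    and unit [simp]: "t \<in> X \<Longrightarrow> ap t x y z = t"
    and gens [simp]: "x \<in> X" "y \<in> X" "z \<in> X"
    and gens_distinct [simp]: "x \<noteq> y" "y \<noteq> z" "x \<noteq> z" "y \<noteq> x" "z \<noteq> y" "z \<noteq> x"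
    and gens_M: "x \<notin> M" "y \<notin> M" "z \<notin> M"
    and M_sub [simp]: "t \<in> M \<Longrightarrow> t \<in> X"
    and majority [simp]: "\<lbrakk>t \<in> M; a \<in> X; b \<in> X\<rbrakk> \<Longrightarrow> ap t a a b = a"
      "\<lbrakk>t \<in> M; a \<in> X; b \<in> X\<rbrakk> \<Longrightarrow> ap t a b a = a" "\<lbrakk>t \<in> M; a \<in> X; b \<in> X\<rbrakk> \<Longrightarrow> ap t b a a = a"
    and ap_in_M: "\<lbrakk>t \<in> M; a \<in> X; b \<in> X; c \<in> X; a \<noteq> b; b \<noteq> c; a \<noteq> c\<rbrakk> \<Longrightarrow> ap t a b c \<in> M"
    and generates: "\<lbrakk>t \<in> M; x \<in> S; y \<in> S; z \<in> S;
      \<And>a b c. \<lbrakk>a \<in> S; b \<in> S; c \<in> S\<rbrakk> \<Longrightarrow> ap t a b c \<in> S\<rbrakk> \<Longrightarrow> M \<subseteq> S"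
    and M_finite: "finite M" and M_card: "card M \<le> 4" and M_nonempty: "M \<noteq> {}"
begin

lemma M_not_gen: "t \<in> M \<Longrightarrow> t \<noteq> x \<and> t \<noteq> y \<and> t \<noteq> z \<and> x \<noteq> t \<and> y \<noteq> t \<and> z \<noteq> t"
  using gens_M by blast

lemma card_M_distinct:
  assumes "set ts \<subseteq> M" "distinct ts"
  shows "length ts \<le> 4"
  using assms M_card card_mono[OF M_finite] by (metis distinct_card le_trans)

section \<open>Cyclic and symmetric operations; the case in which every majority operation is
  cyclic\<close>

definition cyclic :: "'a \<Rightarrow> bool" where
  "cyclic t \<longleftrightarrow> (\<forall>a\<in>X. \<forall>b\<in>X. \<forall>c\<in>X. ap t b c a = ap t a b c)"

definition symmetric :: "'a \<Rightarrow> bool" where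
  "symmetric t \<longleftrightarrow> cyclic t \<and> (\<forall>a\<in>X. \<forall>b\<in>X. \<forall>c\<in>X. ap t b a c = ap t a b c)"

lemma cyclic_iff: "t \<in> X \<Longrightarrow> cyclic t \<longleftrightarrow> ap t y z x = t"
proof
  assume t: "t \<in> X" "ap t y z x = t"
  \<comment> \<open>Applying both sides of an equation in \<open>X\<close> to \<open>a\<close>,
    \<open>b\<close>, \<open>c\<close> and expanding with \<open>assoc\<close> turns it into an
    identity. The later uses of \<open>arg_cong\<close> are substitutions of this kind.\<close>
  have "ap t b c a = ap t a b c" if "a \<in> X" "b \<in> X" "c \<in> X" for a b c
    using arg_cong[OF t(2), of "\<lambda>t. ap t a b c"] that t(1) by (simp add: assoc)
  then show "cyclic t" by (simp add: cyclic_def)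
next
  assume t: "t \<in> X" "cyclic t"
  then have "ap t y z x = ap t x y z" unfolding cyclic_def by (metis gens)
  then show "ap t y z x = t" using t by simp
qed

lemma symmetric_m1:
  assumes "\<And>t. t \<in> M \<Longrightarrow> cyclic t" "s \<in> M" "symmetric s"
  shows "\<exists>e\<in>M. m1_algebra X (ap e)"
proof -
  have closed: "ap t x y u \<in> {t \<in> M. symmetric t}" if "t \<in> M" "symmetric t" "u \<in> M" "symmetric u" for t u
  proof -
    have m: "ap t x y u \<in> M" using that M_not_gen by (intro ap_in_M) auto
    moreover have "ap t b a c = ap t a b c" "ap u b a c = ap u a b c"
      if "a \<in> X" "b \<in> X" "c \<in> X" for a b c
      using that \<open>symmetric t\<close> \<open>symmetric u\<close> by (auto simp: symmetric_def)
    then have "ap (ap t x y u) b a c = ap (ap t x y u) a b c"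
      if "a \<in> X" "b \<in> X" "c \<in> X" for a b c
      using that \<open>t \<in> M\<close> \<open>u \<in> M\<close> by (simp add: assoc)
    \<comment> \<open>The product is visibly invariant only under exchanging its first two
      variables; cyclicity comes from the assumption on all of \<open>M\<close>.\<close>
    ultimately show ?thesis using assms(1) by (simp add: symmetric_def)
  qed
  \<comment> \<open>The product composes \<open>t\<close> and \<open>u\<close> as unary maps in the
    third variable, with \<open>x\<close> and \<open>y\<close> as parameters.\<close>
  have mult_assoc: "ap (ap t x y u) x y w = ap t x y (ap u x y w)" if "t \<in> M" "u \<in> M" "w \<in> M" for t u w
    using that by (simp add: assoc)
  have "finite {t \<in> M. symmetric t}" "{t \<in> M. symmetric t} \<noteq> {}"
    using M_finite assms(2,3) by auto
  then obtain e where "e \<in> {t \<in> M. symmetric t}" and e3: "ap e x y e = e"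
    by (rule finite_semigroup_idempotent[of _ "\<lambda>t u. ap t x y u"])
      (use closed mult_assoc in auto)
  then have e: "e \<in> M" "symmetric e" by auto
  have "ap e a b (ap e a b c) = ap e a b c" if "a \<in> X" "b \<in> X" "c \<in> X" for a b c
    using arg_cong[OF e3, of "\<lambda>t. ap t a b c"] that e(1) by (simp add: assoc)
  moreover have "ap e b a c = ap e a b c" "ap e a c b = ap e a b c"
    if "a \<in> X" "b \<in> X" "c \<in> X" for a b c
    using e(2) that unfolding symmetric_def cyclic_def by metis+
  ultimately have "m1_algebra X (ap e)"
    using e by unfold_locales auto
  then show ?thesis using e(1) by blast
qed

lemma cyclic_not_symmetric:
  assumes cyc: "\<And>t. t \<in> M \<Longrightarrow> cyclic t"
  shows "\<exists>s\<in>M. symmetric s"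
proof (rule ccontr)
  assume no_sym: "\<not> (\<exists>s\<in>M. symmetric s)"
  then have asym: "ap t y x z \<noteq> t" if t: "t \<in> M" for t
  proof -
    have "symmetric t" if "ap t y x z = t"
    proof -
      have "ap t b a c = ap t a b c" if "a \<in> X" "b \<in> X" "c \<in> X" for a b c
        using arg_cong[OF \<open>ap t y x z = t\<close>, of "\<lambda>t. ap t a b c"] that t by (simp add: assoc)
      then show ?thesis using cyc[OF t] by (simp add: symmetric_def)
    qed
    with no_sym t show ?thesis by blast
  qed
  have rot: "ap t b c a = ap t a b c" if "t \<in> M" "a \<in> X" "b \<in> X" "c \<in> X" for t a b c
    using cyc that by (simp add: cyclic_def)
  let ?op = "\<lambda>t. ap t y x z"
  let ?d = "\<lambda>t. ap t x t (?op t)"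
  have op: "?op t \<in> M" if "t \<in> M" for t
    using that by (intro ap_in_M) auto
  have d: "?d t \<in> M" if "t \<in> M" for t
    using that op[OF that] asym[OF that] M_not_gen[of t] M_not_gen[of "?op t"]
    by (intro ap_in_M) auto
  have d1: "ap t a (ap t a b c) (ap t b a c) = ap (?d t) a b c"
    if "t \<in> M" "a \<in> X" "b \<in> X" "c \<in> X" for t a b c
    using that by (simp add: assoc)
  \<comment> \<open>Rotating \<open>a\<close>, \<open>b\<close>, \<open>c\<close> changes neither
    inner value nor \<open>?d t\<close>, so the leading \<open>a\<close> of \<open>d1\<close> may be
    replaced by \<open>b\<close> or \<open>c\<close>.\<close>
  have d2: "ap t b (ap t a b c) (ap t b a c) = ap (?d t) a b c"
    if "t \<in> M" "a \<in> X" "b \<in> X" "c \<in> X" for t a b c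
    using d1[OF that(1,3,4,2)] rot[OF that] rot[OF that(1,3,4,2)]
      rot[OF d[OF that(1)] that(2-4)] rot[OF that(1,3,2,4)] rot[OF that(1,2,4,3)] by simp
  have d3: "ap t c (ap t a b c) (ap t b a c) = ap (?d t) a b c"
    if "t \<in> M" "a \<in> X" "b \<in> X" "c \<in> X" for t a b c
    using d2[OF that(1,3,4,2)] rot[OF that] rot[OF that(1,3,4,2)]
      rot[OF d[OF that(1)] that(2-4)] rot[OF that(1,3,2,4)] rot[OF that(1,2,4,3)] by simp
  have op_d: "ap t a (ap t b a c) (ap t a b c) = ap (?d t) b a c"
    if "t \<in> M" "a \<in> X" "b \<in> X" "c \<in> X" for t a b c
    using d2[OF that(1,3,2,4)] .
  have oo: "?op (?op t) = t" if "t \<in> M" for t using that by (simp add: assoc)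
  have ne: "?d t \<noteq> t \<and> ?d t \<noteq> ?op t" if t: "t \<in> M" for t
  proof -
    define u where "u = ?op t"
    define v where "v = ?d t"
    have uv: "u \<in> M" "v \<in> M" unfolding u_def v_def using t by (auto intro: op d)
    have u: "?op u = t" unfolding u_def using t by (rule oo)
    have v: "ap t x t u = v" by (simp add: u_def v_def)
    have e: "ap t t x u = ?op v"
      using op_d[OF t, of x y z] rot[OF t, of t x u] t uv by (simp add: u_def v_def)
    \<comment> \<open>If \<open>v\<close> is \<open>t\<close> or \<open>u\<close>, the left side of
      the resulting equation collapses to \<open>u\<close> by majority and the right side to
      \<open>t\<close>, although \<open>t\<close> and \<open>u\<close> differ.\<close>
    have "ap t u (ap t x t u) (ap t t x u) = ap (?d t) x t u"
      using d3[OF t, of x t u] t uv by simp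
    then have eq: "ap t u v (?op v) = ap v x t u" by (simp only: v e flip: v_def)
    have "v \<noteq> t"
    proof
      assume "v = t"
      then have "ap t u t u = t" using eq v by (simp flip: u_def)
      then show False using asym[OF t] t uv by (simp flip: u_def)
    qed
    moreover have "v \<noteq> u"
    proof
      assume vu: "v = u"
      have "ap u x t u = ap t t x u"
        using t uv by (simp add: u_def assoc)
      then have "ap t u u t = t" using eq e u by (simp add: vu)
      then show False using asym[OF t] t uv by (simp flip: u_def)
    qed
    ultimately show ?thesis by (simp add: u_def v_def)
  qed
  obtain f where f: "f \<in> M" using M_nonempty by blast
  define f' where "f' = ?op f"
  define g where "g = ?d f"
  define g' where "g' = ?op g"
  have M4: "f \<in> M" "f' \<in> M" "g \<in> M" "g' \<in> M"
    unfolding f'_def g'_def g_def using f by (auto intro: op d)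
  have X: "f \<in> X" "f' \<in> X" "g \<in> X" "g' \<in> X" using M4 by auto
  have swap: "?op f = f'" "?op f' = f" "?op g = g'" "?op g' = g"
    using oo[OF M4(1)] oo[OF M4(3)] by (simp_all add: f'_def g'_def)
  have ne': "f' \<noteq> f" "g' \<noteq> g" "g \<noteq> f" "g \<noteq> f'"
    using asym[OF M4(1)] asym[OF M4(3)] ne[OF M4(1)] by (auto simp: f'_def g'_def g_def)
  then have ne'': "g' \<noteq> f" "g' \<noteq> f'" using swap by auto
  have M: "t \<in> {f, f', g, g'}" if "t \<in> M" for t
  proof (rule ccontr)
    assume "t \<notin> {f, f', g, g'}"
    then have "distinct [f, f', g, g', t]" using ne' ne'' by auto
    then show False using card_M_distinct[of "[f, f', g, g', t]"] that M4 by simp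
  qed
  \<comment> \<open>By \<open>ne\<close> for \<open>g\<close>, only \<open>f\<close> and
    \<open>f'\<close> remain as values of \<open>?d g\<close>.\<close>
  define h where "h = ?d g"
  have h: "h \<in> {f, f'}"
    using ne[OF M4(3)] M[OF d[OF M4(3)]] unfolding h_def g'_def by blast
  define b where "b = ap f x g g'"
  have b: "b \<in> M"
    unfolding b_def using M4 ne' M_not_gen by (intro ap_in_M) auto
  have g_xzy: "ap g x z y = g'" "ap g' x z y = g"
    using rot[OF M4(3), of y x z] rot[OF M4(4), of y x z] by (simp_all add: swap)
  have "?op b = ap b x z y"
    using rot[OF b, of y x z] by simp
  also have "\<dots> = ap f x g' g" unfolding b_def using X g_xzy by (simp add: assoc)
  also have "\<dots> = ap f g x g'" using rot[OF f, of g x g'] X by simp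
  finally have op_b: "ap f g x g' = ?op b" ..
  have gf: "ap f x f f' = g" "ap f x f' f = g'"
    using op_d[OF f, of x y z] X by (simp_all add: g_def f'_def g'_def)
  have "ap (?d f) x g g' = h" by (simp add: h_def g'_def flip: g_def)
  then have dh: "ap f x b (?op b) = h" "ap f g b (?op b) = h" "ap f g' b (?op b) = h"
    using d1[OF f, of x g g'] d2[OF f, of x g g'] d3[OF f, of x g g'] X
    by (simp_all add: op_b flip: b_def)
  \<comment> \<open>If \<open>b\<close> is \<open>f\<close> or \<open>f'\<close>, the leading
    \<open>x\<close> yields \<open>g\<close> or \<open>g'\<close> as the value of \<open>h\<close>.
    If \<open>b\<close> is \<open>g\<close> or \<open>g'\<close>, the leading argument equal to
    \<open>b\<close> yields \<open>b\<close> by majority. Both contradict the choice left for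
    \<open>h\<close>.\<close>
  have "b \<in> {f, f', g, g'}" using b by (rule M)
  then show False
    using dh gf h ne' ne'' M4(1) X by (elim insertE emptyE) (simp_all add: swap)
qed

end

text \<open>By \<open>m1_table\<close> the elements \<open>x\<close>, \<open>y\<close>,
  \<open>z\<close>, \<open>s\<close> are closed under \<open>s\<close>, while every member of
  \<open>M\<close> generates all of \<open>M\<close>.\<close>

lemma (in minimal_ternary_part) m1_algebra_generates:
  assumes "s \<in> M" "m1_algebra X (ap s)"
  shows "M \<subseteq> {s}"
proof -
  interpret m1_algebra X "ap s" by fact
  let ?L = "{0, 1, 2, 3} :: nat set" and ?v = "m1_term (ap s) x y z"
  have "M \<subseteq> ?v ` ?L"
  proof (rule generates[OF assms(1)])
    show "x \<in> ?v ` ?L" by (rule image_eqI[where x = 1]) (simp_all add: m1_term_def)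
    show "y \<in> ?v ` ?L" by (rule image_eqI[where x = 2]) (simp_all add: m1_term_def)
    show "z \<in> ?v ` ?L" by (rule image_eqI[where x = 3]) (simp_all add: m1_term_def)
    fix a b c assume abc: "a \<in> ?v ` ?L" "b \<in> ?v ` ?L" "c \<in> ?v ` ?L"
    obtain i where i: "a = ?v i" "i \<in> ?L" using abc(1) by (rule imageE)
    obtain j where j: "b = ?v j" "j \<in> ?L" using abc(2) by (rule imageE)
    obtain k where k: "c = ?v k" "k \<in> ?L" using abc(3) by (rule imageE)
    note ijk = i(2) j(2) k(2)
    have "ap s a b c = ?v (majority_extension (\<lambda>_ _ _. 0) i j k)"
      using m1_table[OF gens ijk] by (simp only: i(1) j(1) k(1))
    moreover have "majority_extension (\<lambda>_ _ _. 0) i j k \<in> ?L"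
      using ijk by (auto simp: majority_extension_def)
    ultimately show "ap s a b c \<in> ?v ` ?L" by blast
  qed
  also have "?v ` ?L = {s, x, y, z}" using assms(1) by (auto simp: m1_term_def)
  finally show ?thesis using gens_M by blast
qed

lemma (in minimal_ternary_part) m2_algebra_generates:
  assumes "f \<in> M" "m2_algebra X (ap f)"
  shows "M \<subseteq> {f, ap f y x z, ap f z x y}"
proof -
  interpret m2_algebra X "ap f" by fact
  let ?L = "{1, 2, 3} \<times> UNIV :: (nat \<times> bool) set" and ?v = "m2_term (ap f) x y z"
  have "M \<subseteq> ?v ` ?L"
  proof (rule generates[OF assms(1)])
    show "x \<in> ?v ` ?L" by (rule image_eqI[where x = "(1, False)"]) (simp_all add: m2_term_def)
    show "y \<in> ?v ` ?L" by (rule image_eqI[where x = "(2, False)"]) (simp_all add: m2_term_def)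
    show "z \<in> ?v ` ?L" by (rule image_eqI[where x = "(3, False)"]) (simp_all add: m2_term_def)
    fix a b c assume abc: "a \<in> ?v ` ?L" "b \<in> ?v ` ?L" "c \<in> ?v ` ?L"
    obtain i where i: "a = ?v i" "i \<in> ?L" using abc(1) by (rule imageE)
    obtain j where j: "b = ?v j" "j \<in> ?L" using abc(2) by (rule imageE)
    obtain k where k: "c = ?v k" "k \<in> ?L" using abc(3) by (rule imageE)
    note ijk = i(2) j(2) k(2)
    have "ap f a b c = ?v (m2_label i j k)"
      using m2_table[OF gens ijk] by (simp only: i(1) j(1) k(1))
    then show "ap f a b c \<in> ?v ` ?L"
      using imageI[OF m2_label_closed[OF ijk], of ?v] by (simp only:)
  qed
  also have "?v ` ?L \<subseteq> {x, y, z, f, ap f y x z, ap f z x y}"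
  proof (rule image_subsetI)
    fix l assume "l \<in> ?L"
    then obtain i p where "l = (i, p)" "i = 1 \<or> i = 2 \<or> i = 3" by (cases l) auto
    then show "?v l \<in> {x, y, z, f, ap f y x z, ap f z x y}"
      using assms(1) by (cases p) (auto simp: m2_term_def)
  qed
  finally show ?thesis using gens_M by blast
qed

text \<open>As in \<^locale>\<open>m2_algebra\<close>, \<open>ap f a b c\<close> is to be read as \<open>f(a | b, c)\<close>.\<close>

locale noncyclic_ternary_part = minimal_ternary_part +
  fixes f f2 f3
  assumes f: "f \<in> M" and f_sym: "\<lbrakk>a \<in> X; b \<in> X; c \<in> X\<rbrakk> \<Longrightarrow> ap f a c b = ap f a b c"
    and f_not_cyclic: "\<not> cyclic f"
  defines "f2 \<equiv> ap f y x z" and "f3 \<equiv> ap f z x y"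
begin

section \<open>The noncyclic case: three conjugate operations and at most one further one\<close>

lemma f_M [simp]: "f \<in> M" "f2 \<in> M" "f3 \<in> M"
  unfolding f2_def f3_def using f by (auto intro!: ap_in_M)

lemma ap_f2_f3 [simp]:
  "\<lbrakk>a \<in> X; b \<in> X; c \<in> X\<rbrakk> \<Longrightarrow> ap f2 a b c = ap f b a c"
  "\<lbrakk>a \<in> X; b \<in> X; c \<in> X\<rbrakk> \<Longrightarrow> ap f3 a b c = ap f c a b"
  by (simp_all add: f2_def f3_def assoc)

lemma f_gens: "ap f x z y = f" "ap f y x z = f2" "ap f y z x = f2" "ap f z x y = f3" "ap f z y x = f3"
  using f_sym[of x y z] f_sym[of y x z] f_sym[of z x y] by (simp_all add: f2_def f3_def)

text \<open>\<open>f = f2\<close> would make \<open>f\<close> cyclic, and exchanging two variables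
  carries the other coincidences to this one.\<close>

lemma f_distinct: "f \<noteq> f2" "f \<noteq> f3" "f2 \<noteq> f3" "f2 \<noteq> f" "f3 \<noteq> f" "f3 \<noteq> f2"
proof -
  have "ap f y z x \<noteq> f" using f_not_cyclic cyclic_iff[of f] by simp
  then show 2: "f \<noteq> f2" "f2 \<noteq> f" by (auto simp: f_gens)
  have "ap f2 y x z = f" "ap f3 y x z = f3" "ap f x z y = f" "ap f3 x z y = f2"
    by (simp_all add: f_gens)
  then show 3: "f2 \<noteq> f3" "f \<noteq> f3" using 2 by metis+
  then show "f3 \<noteq> f" "f3 \<noteq> f2" using 3 by auto
qed

text \<open>Exchanging \<open>y\<close> and \<open>z\<close> fixes \<open>f\<close> and swaps
  \<open>f2\<close> with \<open>f3\<close>.\<close>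

lemma invariant_23:
  assumes "t \<in> M" "ap t x z y = t"
  shows "t \<noteq> f2" "t \<noteq> f3"
  using assms f_distinct by (auto simp: f_gens)

lemma invariant_12:
  assumes "t \<in> M" "ap t y x z = t"
  shows "t \<noteq> f" "t \<noteq> f2"
  using assms f_distinct by (auto simp: f_gens)

lemma M_cases: "M = {f, f2, f3} \<or> (\<exists>s. s \<notin> {f, f2, f3} \<and> M = {f, f2, f3, s})"
proof (cases "M \<subseteq> {f, f2, f3}")
  case True
  then show ?thesis by auto
next
  case False
  then obtain s where s: "s \<in> M" "s \<notin> {f, f2, f3}" by blast
  have "t \<in> {f, f2, f3, s}" if "t \<in> M" for t
  proof (rule ccontr)
    assume "t \<notin> {f, f2, f3, s}"
    then have "distinct [f, f2, f3, s, t]" using s f_distinct by auto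
    then show False using card_M_distinct[of "[f, f2, f3, s, t]"] s that by simp
  qed
  then have "M = {f, f2, f3, s}" using s by auto
  with s show ?thesis by blast
qed

text \<open>Only \<open>f\<close> is invariant under exchanging \<open>y\<close> and
  \<open>z\<close>, which settles the laws whose left side has this invariance. For the other two,
  substitutions rule out \<open>f2\<close> and \<open>f3\<close>.\<close>

lemma three_majorities:
  assumes M: "M = {f, f2, f3}"
  shows "m2_algebra X (ap f)"
proof -
  have f_inv: "t = f" if "t \<in> M" "ap t x z y = t" for t
    using invariant_23[OF that] that M by auto
  note dist = f_distinct M_not_gen[of f] M_not_gen[of f2] M_not_gen[of f3]
  have e3: "ap f x f2 f3 = f"
    using dist f_sym[of x f2 f3] by (intro f_inv ap_in_M) (simp_all add: assoc f_gens)
  have I3: "ap f a (ap f b a c) (ap f c a b) = ap f a b c" if "a \<in> X" "b \<in> X" "c \<in> X" for a b c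
    using arg_cong[OF e3, of "\<lambda>t. ap t a b c"] that by (simp add: assoc)
  have e4: "ap f f y z = f"
    using dist f_sym[of f y z] by (intro f_inv ap_in_M) (simp_all add: assoc f_gens)
  have I4: "ap f (ap f a b c) b c = ap f a b c" if "a \<in> X" "b \<in> X" "c \<in> X" for a b c
    using arg_cong[OF e4, of "\<lambda>t. ap t a b c"] that by (simp add: assoc)
  have e5: "ap f f f2 f3 = f"
    using dist f_sym[of f f2 f3] by (intro f_inv ap_in_M) (simp_all add: assoc f_gens)
  have I5: "ap f (ap f a b c) (ap f b a c) (ap f c a b) = ap f a b c"
    if "a \<in> X" "b \<in> X" "c \<in> X" for a b c
    using arg_cong[OF e5, of "\<lambda>t. ap t a b c"] that by (simp add: assoc)
  \<comment> \<open>Thus substituting \<open>f\<close>, \<open>f2\<close>, \<open>f3\<close> for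
    \<open>x\<close>, \<open>y\<close>, \<open>z\<close> fixes all three operations, and a wrong
    value below is refuted by majority.\<close>
  have I5': "ap f f f2 f3 = f" "ap f f2 f f3 = f2" "ap f f3 f f2 = f3"
    using I5[of x y z] I5[of y x z] I5[of z x y] by (simp_all add: f_gens)
  have "ap f x y f \<noteq> f2"
  proof
    assume "ap f x y f = f2"
    from arg_cong[OF this, of "\<lambda>t. ap t f f2 f3"] have "ap f f f2 (ap f f f2 f3) = ap f f2 f f3"
      by (simp add: assoc)
    then show False using f_distinct by (simp add: I5')
  qed
  moreover have "ap f x y f \<noteq> f3"
  proof
    assume "ap f x y f = f3"
    from arg_cong[OF this, of "\<lambda>t. ap t f f2 f3"] have "ap f f f2 (ap f f f2 f3) = ap f f3 f f2"
      by (simp add: assoc)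
    then show False using f_distinct by (simp add: I5')
  qed
  moreover have "ap f x y f \<in> M" using dist by (intro ap_in_M) auto
  ultimately have e1: "ap f x y f = f" using M by auto
  have I1: "ap f a b (ap f a b c) = ap f a b c" if "a \<in> X" "b \<in> X" "c \<in> X" for a b c
    using arg_cong[OF e1, of "\<lambda>t. ap t a b c"] that by (simp add: assoc)
  have "ap f x y f3 \<noteq> f2"
  proof
    assume *: "ap f x y f3 = f2"
    from arg_cong[OF this, of "\<lambda>t. ap t x y f3"] have "ap f x y (ap f f3 x y) = ap f y x f3"
      by (simp add: assoc)
    moreover have "ap f f3 x y = f3" using I4[of z x y] by (simp add: f_gens)
    moreover have "ap f y x f3 = f"
      using arg_cong[OF *, of "\<lambda>t. ap t y x z"] by (simp add: assoc f_gens)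
    ultimately show False using * f_distinct by simp
  qed
  moreover have "ap f x y f3 \<noteq> f3"
  proof
    assume "ap f x y f3 = f3"
    from arg_cong[OF this, of "\<lambda>t. ap t f f2 z"] have "ap f f f2 (ap f z f f2) = ap f z f f2"
      by (simp add: assoc)
    moreover have "ap f z f f2 = f3" using I3[of z x y] by (simp add: f_gens)
    ultimately show False using f_distinct by (simp add: I5')
  qed
  moreover have "ap f x y f3 \<in> M" using dist by (intro ap_in_M) auto
  ultimately have e2: "ap f x y f3 = f" using M by auto
  have I2: "ap f a b (ap f c a b) = ap f a b c" if "a \<in> X" "b \<in> X" "c \<in> X" for a b c
    using arg_cong[OF e2, of "\<lambda>t. ap t a b c"] that by (simp add: assoc)
  show ?thesis
    by unfold_locales (simp_all add: f_sym I1 I2 I3 I4 I5)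
qed

text \<open>Values are determined one at a time by excluding the other members of \<open>M\<close>.
  The main tools are \<open>star\<close>, which expresses \<open>f\<close> through \<open>s\<close>,
  and \<open>s_maj\<close>, which evaluates \<open>s\<close> as soon as two of the three inner
  values agree.\<close>

lemma four_majorities:
  assumes s: "s \<notin> {f, f2, f3}" and M: "M = {f, f2, f3, s}"
  shows False
proof -
  have sM [simp]: "s \<in> M" using M by simp
  have sX [simp]: "s \<in> X" by (rule M_sub) simp
  have ne: "f \<noteq> s" "f2 \<noteq> s" "f3 \<noteq> s" "s \<noteq> f" "s \<noteq> f2" "s \<noteq> f3" using s by auto
  note dist = f_distinct ne M_not_gen[of f] M_not_gen[of f2] M_not_gen[of f3] M_not_gen[of s]
  \<comment> \<open>Both exchanges are involutions preserving the set of \<open>f\<close>,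
    \<open>f2\<close>, \<open>f3\<close>, so they fix the remaining element.\<close>
  have s_gens: "ap s y x z = s" "ap s x z y = s"
  proof -
    have perm: "ap t y x z \<in> {f, f2, f3}" "ap t x z y \<in> {f, f2, f3}" if "t \<in> {f, f2, f3}" for t
      using that by (auto simp: f_gens)
    have in_M: "ap s y x z \<in> {f, f2, f3, s}" "ap s x z y \<in> {f, f2, f3, s}"
      unfolding M[symmetric] by (auto intro: ap_in_M)
    have "ap (ap s y x z) y x z = s" "ap (ap s x z y) x z y = s" by (simp_all add: assoc)
    then have "ap s y x z \<notin> {f, f2, f3}" "ap s x z y \<notin> {f, f2, f3}"
      using perm(1)[of "ap s y x z"] perm(2)[of "ap s x z y"] s by (simp_all only: simp_thms) blast+
    then show "ap s y x z = s" "ap s x z y = s" using in_M by blast+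
  qed
  have s_sym: "ap s b a c = ap s a b c" "ap s a c b = ap s a b c"
    if "a \<in> X" "b \<in> X" "c \<in> X" for a b c
    using arg_cong[OF s_gens(1), of "\<lambda>t. ap t a b c"] arg_cong[OF s_gens(2), of "\<lambda>t. ap t a b c"]
      that by (simp_all add: assoc)
  have s_gens': "ap s y z x = s" "ap s z x y = s" "ap s z y x = s"
    using s_gens by (simp_all add: s_sym)
  note gens = f_gens s_gens s_gens'
  have s123: "ap s f f2 f3 = s"
  proof -
    have "ap s f f2 f3 \<in> M" using dist by (intro ap_in_M) auto
    moreover have "ap (ap s f f2 f3) y x z = ap s f f2 f3" "ap (ap s f f2 f3) x z y = ap s f f2 f3"
      by (simp_all add: assoc gens s_sym)
    ultimately show ?thesis
      using invariant_12[of "ap s f f2 f3"] invariant_23[of "ap s f f2 f3"] M by blast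
  qed
  \<comment> \<open>Invariance under exchanging \<open>x\<close> and \<open>y\<close> leaves
    \<open>f3\<close> and \<open>s\<close>. The value \<open>s\<close> would make \<open>s\<close>
    absorbing as in \<open>m1_algebra\<close>, so that it generates no other member of
    \<open>M\<close>.\<close>
  have star0: "ap s x y s = f3"
  proof -
    have "ap s x y s \<in> M" using dist by (intro ap_in_M) auto
    moreover have "ap (ap s x y s) y x z = ap s x y s" by (simp add: assoc gens s_sym)
    moreover have "ap s x y s \<noteq> s"
    proof
      assume e: "ap s x y s = s"
      have "ap s a b (ap s a b c) = ap s a b c" if "a \<in> X" "b \<in> X" "c \<in> X" for a b c
        using arg_cong[OF e, of "\<lambda>t. ap t a b c"] that by (simp add: assoc)
      then have "m1_algebra X (ap s)" by unfold_locales (simp_all add: s_sym)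
      then show False using m1_algebra_generates[of s] M ne by auto
    qed
    ultimately show ?thesis using invariant_12[of "ap s x y s"] M by blast
  qed
  have star: "ap s a b (ap s a b c) = ap f c a b" if "a \<in> X" "b \<in> X" "c \<in> X" for a b c
    using arg_cong[OF star0, of "\<lambda>t. ap t a b c"] that by (simp add: assoc)
  have s_maj: "ap s (ap f a b c) (ap f b a c) (ap f c a b) = ap s a b c"
    if "a \<in> X" "b \<in> X" "c \<in> X" for a b c
    using arg_cong[OF s123, of "\<lambda>t. ap t a b c"] that by (simp add: assoc)
  have first: "ap f f y f3 = f"
  proof -
    have "ap f f y f3 \<in> M" using dist by (intro ap_in_M) auto
    moreover have False if e: "ap f f y f3 = f3"
    proof -
      have H: "ap f (ap f a b c) b (ap f c a b) = ap f c a b" if "a \<in> X" "b \<in> X" "c \<in> X" for a b c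
        using arg_cong[OF e, of "\<lambda>t. ap t a b c"] that by (simp add: assoc)
      define k where "k = ap f z f f2"
      have "ap f f f2 z = f2" using H[of x z y] f_sym[of f z f2] by (simp add: gens)
      then have "ap f f2 f2 k = k" using H[of f f2 z] unfolding k_def by simp
      then have "k = f2" by (simp add: k_def)
      \<comment> \<open>\<open>k\<close> is invariant under exchanging \<open>x\<close> and
        \<open>y\<close>, but \<open>f2\<close> is not.\<close>
      moreover have "ap k y x z = k" unfolding k_def by (simp add: assoc gens f_sym[of z f f2])
      ultimately show False using f_distinct by (simp add: gens)
    qed
    moreover have False if e: "ap f f y f3 = f2"
    proof -
      have H: "ap f (ap f a b c) b (ap f c a b) = ap f b a c" if "a \<in> X" "b \<in> X" "c \<in> X" for a b c
        using arg_cong[OF e, of "\<lambda>t. ap t a b c"] that by (simp add: assoc)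
      have "ap f f2 x f3 = f" "ap f f3 x f2 = f" using H[of y x z] H[of z x y] by (simp_all add: gens)
      then have s1: "ap s x f2 f3 = f" using s_maj[of x f2 f3] by simp
      have s2: "ap s a (ap f b a c) (ap f c a b) = ap f a b c" if "a \<in> X" "b \<in> X" "c \<in> X" for a b c
        using arg_cong[OF s1, of "\<lambda>t. ap t a b c"] that by (simp add: assoc)
      have "ap f f3 f y = f2" using H[of z y x] f_sym[of f3 y f] by (simp add: gens)
      then have "ap f y f f3 = f2" using H[of f y f3] e by simp
      moreover have "ap s f f3 y = f2" using s2[of y x z] by (simp add: gens s_sym)
      moreover have "ap s f f3 f2 = s" using s123 by (simp add: s_sym)
      \<comment> \<open>Here \<open>star\<close> reads \<open>s = f2\<close>: its inner value is
        \<open>f2\<close>, and \<open>s\<close> takes the value \<open>s\<close> at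
        \<open>f\<close>, \<open>f3\<close>, \<open>f2\<close>.\<close>
      ultimately show False using star[of f f3 y] ne by simp
    qed
    moreover have False if e: "ap f f y f3 = s"
    proof -
      have H: "ap f (ap f a b c) b (ap f c a b) = ap s a b c" if "a \<in> X" "b \<in> X" "c \<in> X" for a b c
        using arg_cong[OF e, of "\<lambda>t. ap t a b c"] that by (simp add: assoc)
      have f23: "ap f f2 x f3 = s" "ap f f3 x f2 = s"
        using H[of y x z] H[of z x y] by (simp_all add: gens)
      then have "ap s x f2 f3 = s" using s_maj[of x f2 f3] by simp
      then have s1: "ap s x f2 s = s" using star[of x f2 f3] f23 by simp
      have s2: "ap s a (ap f b a c) (ap s a b c) = ap s a b c" if "a \<in> X" "b \<in> X" "c \<in> X" for a b c
        using arg_cong[OF s1, of "\<lambda>t. ap t a b c"] that by (simp add: assoc)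
      have "ap s x s y = f3" using star0 by (simp add: s_sym)
      moreover have "ap s x s f3 = s" using s2[of x z y] s_sym[of x s f3] by (simp add: gens)
      ultimately have yxs: "ap f y x s = s" using star[of x s y] by simp
      have "ap f x y s = s" using arg_cong[OF yxs, of "\<lambda>t. ap t y x z"] by (simp add: assoc gens)
      then have "ap s x y s = s" using s_maj[of x y s] yxs by simp
      then show False using star0 ne by simp
    qed
    ultimately show ?thesis unfolding M by blast
  qed
  have A: "ap f (ap f a b c) b (ap f c a b) = ap f a b c" if "a \<in> X" "b \<in> X" "c \<in> X" for a b c
    using arg_cong[OF first, of "\<lambda>t. ap t a b c"] that by (simp add: assoc)
  have Af: "ap f f y f3 = f" "ap f f z f2 = f" "ap f f2 x f3 = f2" "ap f f2 z f = f2"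
    "ap f f3 x f2 = f3" "ap f f3 y f = f3"
    using A[of x y z] A[of x z y] A[of y x z] A[of y z x] A[of z x y] A[of z y x]
    by (simp_all add: gens)
  have Af': "ap f f f3 y = f" "ap f f f2 z = f" "ap f f2 f3 x = f2" "ap f f2 f z = f2"
    "ap f f3 f2 x = f3" "ap f f3 f y = f3"
    using Af by (simp_all add: f_sym)
  \<comment> \<open>Invariance under exchanging \<open>y\<close> and \<open>z\<close> leaves only
    \<open>f\<close> to exclude.\<close>
  have sx23: "ap s x f2 f3 = s"
  proof -
    have "ap s x f2 f3 \<in> M" using dist by (intro ap_in_M) auto
    moreover have "ap (ap s x f2 f3) x z y = ap s x f2 f3" by (simp add: assoc gens s_sym)
    moreover have False if e: "ap s x f2 f3 = f"
    proof -
      have H: "ap s a (ap f b a c) (ap f c a b) = ap f a b c" if "a \<in> X" "b \<in> X" "c \<in> X" for a b c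
        using arg_cong[OF e, of "\<lambda>t. ap t a b c"] that by (simp add: assoc)
      have "ap s f f2 z = f3" using H[of z x y] by (simp add: gens s_sym)
      then have zff: "ap f z f f2 = s" using star[of f f2 z] s123 by simp
      have "ap f x f2 f3 = s" using arg_cong[OF zff, of "\<lambda>t. ap t y z x"] by (simp add: assoc gens)
      moreover have "ap s x f2 f3 = ap f x f2 f3"
        using H[of x f2 f3] by (simp add: Af)
      ultimately show False using e ne by simp
    qed
    ultimately show ?thesis using invariant_23[of "ap s x f2 f3"] unfolding M by blast
  qed
  have B: "ap s a (ap f b a c) (ap f c a b) = ap s a b c" if "a \<in> X" "b \<in> X" "c \<in> X" for a b c
    using arg_cong[OF sx23, of "\<lambda>t. ap t a b c"] that by (simp add: assoc)
  have Bf: "ap s y f f3 = s" "ap s z f f2 = s"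
    using B[of y x z] B[of z x y] by (simp_all add: gens)
  \<comment> \<open>Each substitution makes two arguments on the left equal to \<open>f\<close>,
    while the wrong value on the right is preserved.\<close>
  have sxyf: "ap s x y f = f"
  proof -
    have "ap s x y f \<in> M" using dist by (intro ap_in_M) auto
    moreover have False if e: "ap s x y f = s"
      using arg_cong[OF e, of "\<lambda>t. ap t f y f3"] Bf s_sym[of y f f3] ne by (simp add: assoc Af)
    moreover have False if e: "ap s x y f = f2"
      using arg_cong[OF e, of "\<lambda>t. ap t f f2 z"] f_distinct by (simp add: assoc Af Af')
    moreover have False if e: "ap s x y f = f3"
      using arg_cong[OF e, of "\<lambda>t. ap t f y f3"] f_distinct by (simp add: assoc Af Af')
    ultimately show ?thesis unfolding M by blast
  qed
  have R: "ap s a b (ap f a b c) = ap f a b c" if "a \<in> X" "b \<in> X" "c \<in> X" for a b c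
    using arg_cong[OF sxyf, of "\<lambda>t. ap t a b c"] that by (simp add: assoc)
  have I1: "ap f a b (ap f a b c) = ap f a b c" if abc: "a \<in> X" "b \<in> X" "c \<in> X" for a b c
  proof -
    have "ap s b (ap f a b c) a = ap f a b c"
      using R[OF abc] abc s_sym(1)[of a b "ap f a b c"] s_sym(2)[of b a "ap f a b c"] by simp
    then show ?thesis using star[of b "ap f a b c" a] abc by simp
  qed
  have sxf2s: "ap s x f2 s = f3" using star[of x f2 f3] sx23 Af by simp
  have "ap s x f3 s = f2"
    using arg_cong[OF sxf2s, of "\<lambda>t. ap t x z y"] by (simp add: assoc gens)
  then have "ap s x s f3 = f2" using s_sym[of x s f3] by simp
  moreover have "ap s x s y = f3" using star0 by (simp add: s_sym)
  ultimately have fyxs: "ap f y x s = f2" using star[of x s y] by simp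
  have fxys: "ap f x y s = f"
    using arg_cong[OF fyxs, of "\<lambda>t. ap t y x z"] by (simp add: assoc gens)
  \<comment> \<open>Substituting \<open>s\<close> for \<open>z\<close> in \<open>fxys\<close> brings
    in \<open>s(x, y, s)\<close>, which is \<open>f3\<close> by \<open>star0\<close>.\<close>
  have "ap f x y (ap s x y s) = ap f x y s"
    using arg_cong[OF fxys, of "\<lambda>t. ap t x y s"] by (simp add: assoc)
  then have e2: "ap f x y f3 = f" by (simp add: star0 fxys)
  have I2: "ap f a b (ap f c a b) = ap f a b c" if "a \<in> X" "b \<in> X" "c \<in> X" for a b c
    using arg_cong[OF e2, of "\<lambda>t. ap t a b c"] that by (simp add: assoc)
  have "ap s s (ap f x s y) (ap f y s x) = ap s s x y" using B[of s x y] by simp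
  then have "ap s s f f2 = f3"
    using fxys fyxs f_sym[of x y s] f_sym[of y x s] star0 s_sym(1)[of s x y] s_sym(2)[of x s y] by simp
  then have sff2: "ap s f f2 s = f3" by (simp add: s_sym)
  have e3: "ap f z f f2 = f3"
    using star[of f f2 z] Bf sff2 s_sym[of f z f2] by simp
  have e3': "ap f x f2 f3 = f"
    using arg_cong[OF e3, of "\<lambda>t. ap t y z x"] by (simp add: assoc gens)
  have I3: "ap f a (ap f b a c) (ap f c a b) = ap f a b c" if "a \<in> X" "b \<in> X" "c \<in> X" for a b c
    using arg_cong[OF e3', of "\<lambda>t. ap t a b c"] that by (simp add: assoc)
  have e5: "ap f f3 f f2 = f3" using star[of f f2 f3] s123 sff2 by simp
  have e5': "ap f f f2 f3 = f"
    using arg_cong[OF e5, of "\<lambda>t. ap t y z x"] by (simp add: assoc gens)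
  have I5: "ap f (ap f a b c) (ap f b a c) (ap f c a b) = ap f a b c"
    if "a \<in> X" "b \<in> X" "c \<in> X" for a b c
    using arg_cong[OF e5', of "\<lambda>t. ap t a b c"] that by (simp add: assoc)
  have "ap f z f y = f3" using I2[of z y x] f_sym[of z y f] by (simp add: gens)
  then have e4: "ap f f y z = f" using I2[of f y z] Af by simp
  have I4: "ap f (ap f a b c) b c = ap f a b c" if "a \<in> X" "b \<in> X" "c \<in> X" for a b c
    using arg_cong[OF e4, of "\<lambda>t. ap t a b c"] that by (simp add: assoc)
  have "m2_algebra X (ap f)"
    by unfold_locales (simp_all add: f_sym I1 I2 I3 I4 I5)
  then have "M \<subseteq> {f, f2, f3}" using m2_algebra_generates[of f] by (simp add: f_gens)
  then show False using s sM by blast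
qed

lemma m2_algebra_f: "m2_algebra X (ap f)"
  using M_cases three_majorities four_majorities by blast

end

section \<open>Reduction of a noncyclic operation to one symmetric in its last two variables\<close>

context minimal_ternary_part
begin

text \<open>The three rotations of \<open>t\<close> are distinct. If exchanging \<open>y\<close> and
  \<open>z\<close> led outside them, \<open>M\<close> would have five elements; so some exchange of
  two variables fixes an element of the orbit of \<open>t\<close>.\<close>

lemma noncyclic_m2:
  assumes t: "t \<in> M" "\<not> cyclic t"
  shows "\<exists>f\<in>M. m2_algebra X (ap f) \<and> distinct [f, ap f y x z, ap f z x y]"
proof -
  have X: "t \<in> X" using t by simp
  have perms: "ap t y z x \<in> M" "ap t z x y \<in> M" "ap t x z y \<in> M" "ap t y x z \<in> M"
    using t(1) by (auto intro: ap_in_M)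
  have 1: "ap t y z x \<noteq> t" using t cyclic_iff[OF X] by simp
  have 2: "ap t z x y \<noteq> t"
  proof
    assume "ap t z x y = t"
    from arg_cong[OF this, of "\<lambda>t. ap t y z x"] show False using 1 X by (simp add: assoc)
  qed
  have 3: "ap t y z x \<noteq> ap t z x y"
  proof
    assume "ap t y z x = ap t z x y"
    from arg_cong[OF this, of "\<lambda>t. ap t y z x"] show False using 2 X by (simp add: assoc)
  qed
  have "ap t x z y \<in> {t, ap t y z x, ap t z x y}"
  proof (rule ccontr)
    assume *: "ap t x z y \<notin> {t, ap t y z x, ap t z x y}"
    have "ap t y x z \<noteq> t"
    proof
      assume "ap t y x z = t"
      from arg_cong[OF this, of "\<lambda>t. ap t z x y"] show False using * X by (simp add: assoc)
    qed
    moreover have "ap t y x z \<noteq> ap t y z x"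
    proof
      assume "ap t y x z = ap t y z x"
      from arg_cong[OF this, of "\<lambda>t. ap t y x z"] show False using * X by (simp add: assoc)
    qed
    moreover have "ap t y x z \<noteq> ap t z x y"
    proof
      assume "ap t y x z = ap t z x y"
      from arg_cong[OF this, of "\<lambda>t. ap t z x y"] show False using * X by (simp add: assoc)
    qed
    moreover have "ap t y x z \<noteq> ap t x z y"
    proof
      assume "ap t y x z = ap t x z y"
      from arg_cong[OF this, of "\<lambda>t. ap t y x z"] show False using 1 2 X by (simp add: assoc)
    qed
    ultimately have "distinct [t, ap t y z x, ap t z x y, ap t x z y, ap t y x z]"
      using * 1 2 3 by auto
    then show False
      using card_M_distinct[of "[t, ap t y z x, ap t z x y, ap t x z y, ap t y x z]"] t perms
      by simp
  qed
  then consider "ap t x z y = t" | "ap t x z y = ap t y z x" | "ap t x z y = ap t z x y" by blast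
  then obtain f where f: "f \<in> M" "ap f x z y = f" "\<not> cyclic f"
  proof cases
    case 1
    then show thesis using that t by blast
  next
    case 2
    \<comment> \<open>Renaming the variables turns the available invariance into that under
      exchanging \<open>y\<close> and \<open>z\<close>.\<close>
    let ?f = "ap t y x z"
    have "ap ?f x z y = ?f"
      using arg_cong[OF 2, of "\<lambda>t. ap t z y x"] X by (simp add: assoc)
    moreover have "ap t y z x = t" if "cyclic ?f"
    proof -
      have "ap ?f z y x = ap ?f x z y" "ap ?f x z y = ap ?f y x z"
        using that gens unfolding cyclic_def by metis+
      then show ?thesis using X by (simp add: assoc)
    qed
    ultimately show thesis using that \<open>ap t y z x \<noteq> t\<close> perms by blast
  next
    case 3
    let ?f = "ap t y z x"
    have "ap ?f x z y = ?f"
      using arg_cong[OF 3, of "\<lambda>t. ap t z x y"] X by (simp add: assoc)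
    moreover have "ap t y z x = t" if "cyclic ?f"
    proof -
      have "ap ?f x y z = ap ?f z x y"
        using that gens unfolding cyclic_def by metis
      then show ?thesis using X by (simp add: assoc)
    qed
    ultimately show thesis using that \<open>ap t y z x \<noteq> t\<close> perms by blast
  qed
  have nc: "noncyclic_ternary_part X M ap x y z f"
  proof
    fix a b c assume "a \<in> X" "b \<in> X" "c \<in> X"
    then show "ap f a c b = ap f a b c"
      using arg_cong[OF f(2), of "\<lambda>t. ap t a b c"] f(1) by (simp add: assoc)
  qed (use f in auto)
  show ?thesis
    using f(1) noncyclic_ternary_part.m2_algebra_f[OF nc] noncyclic_ternary_part.f_distinct[OF nc]
    by auto
qed

lemma m1_or_m2:
  "\<exists>f\<in>M. m1_algebra X (ap f) \<or> m2_algebra X (ap f) \<and> distinct [f, ap f y x z, ap f z x y]"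
proof (cases "\<forall>t\<in>M. cyclic t")
  case True
  then show ?thesis using symmetric_m1 cyclic_not_symmetric by metis
next
  case False
  then show ?thesis using noncyclic_m2 by metis
qed

end

section \<open>Ternary operations of majority minimal clones\<close>

lemma (in abstract_clone) majority_operation_idem:
  assumes f: "majority_operation C f" and ab: "a \<in> ops C k" "b \<in> ops C k"
  shows "composition C 3 k f [a, a, b] = a" "composition C 3 k f [a, b, a] = a"
    "composition C 3 k f [b, a, a] = a"
proof -
  let ?p = "proj C 2 (Suc 0)" and ?q = "proj C 2 2"
  have pq: "?p \<in> ops C 2" "?q \<in> ops C 2" by (auto intro: proj_closed)
  have "composition C 2 k (composition C 3 2 f [u, v, w]) [a, b] =
      composition C 3 k f
        [composition C 2 k u [a, b], composition C 2 k v [a, b], composition C 2 k w [a, b]]"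
    if "u \<in> ops C 2" "v \<in> ops C 2" "w \<in> ops C 2" for u v w
    using that ab f by (intro comp_assoc_3) (auto simp: majority_operation_def)
  note this[OF pq(1,1,2)] this[OF pq(1,2,1)] this[OF pq(2,1,1)]
  then show "composition C 3 k f [a, a, b] = a" "composition C 3 k f [a, b, a] = a"
    "composition C 3 k f [b, a, a] = a"
    using f ab by (simp_all add: majority_operation_def comp_2_proj)
qed

locale majority_generated_clone = abstract_clone +
  fixes f
  assumes f_majority: "majority_operation C f" and f_generates: "generated_clone C 3 f = C"
    and minimal: "minimal_clone C"
begin

abbreviation "p \<equiv> proj C 2 (Suc 0)"
abbreviation "q \<equiv> proj C 2 2"
abbreviation "x \<equiv> proj C 3 (Suc 0)"
abbreviation "y \<equiv> proj C 3 2"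
abbreviation "z \<equiv> proj C 3 3"

lemma projections_closed [simp]:
  "p \<in> ops C 2" "q \<in> ops C 2" "x \<in> ops C 3" "y \<in> ops C 3" "z \<in> ops C 3"
  by (auto intro: proj_closed)

lemma projections_3: "projections C 3 = {x, y, z}"
proof -
  have "{1..3} = {Suc 0, 2, 3}" by auto
  then show ?thesis by (simp add: projections_def)
qed

lemma f_closed: "f \<in> ops C 3"
  using f_majority by (simp add: majority_operation_def)

lemma nontrivial_generates:
  assumes "t \<in> ops C 3" "t \<notin> projections C 3"
  shows "generated_clone C 3 t = C"
proof -
  have "subclone C (ops (generated_clone C 3 t))" "t \<in> ops (generated_clone C 3 t) 3"
    using abstract_clone_axioms assms(1) by (rule subclone_generated_clone)+
  moreover from this have "ops (generated_clone C 3 t) \<in> {projections C, ops C}"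
    using minimal unfolding minimal_clone_def by (metis mem_Collect_eq)
  ultimately have "ops (generated_clone C 3 t) = ops C" using assms(2) by auto
  moreover have "generated_clone C 3 t = C\<lparr>ops := ops (generated_clone C 3 t)\<rparr>"
    by (simp add: generated_clone_def)
  ultimately show ?thesis by simp
qed

lemma f_nontrivial: "f \<notin> projections C 3"
proof
  assume f: "f \<in> projections C 3"
  have proj: "subclone C (projections C)" and ne: "projections C \<noteq> ops C"
    using minimal by (auto simp: minimal_clone_def)
  have "ops C k \<subseteq> projections C k" for k
  proof -
    have "ops (generated_clone C 3 f) k \<subseteq> projections C k"
      using proj f by (auto simp: generated_clone_def)
    then show ?thesis by (simp add: f_generates)
  qed
  moreover have "projections C k \<subseteq> ops C k" for k using proj by (simp add: subclone_def)
  ultimately show False using ne by (metis ext subset_antisym)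
qed

text \<open>If the binary projections coincide, so do the ternary ones, and \<open>f\<close> becomes
  \<open>f(x, x, x)\<close>, a projection.\<close>

lemma pq: "p \<noteq> q"
proof
  assume eq: "p = q"
  have "composition C 2 3 p [x, y] = x" "composition C 2 3 q [x, y] = y"
    "composition C 2 3 p [x, z] = x" "composition C 2 3 q [x, z] = z"
    by (simp_all add: comp_2_proj)
  then have "x = y" "x = z" using eq by auto
  then have "f = ternary_comp C f x x x" using comp_3_proj_right[OF f_closed] by simp
  also have "\<dots> = x" using majority_operation_idem[OF f_majority, of x 3 x] by simp
  finally show False using f_nontrivial projections_3 by simp
qed

text \<open>The clone acts on the two-element set of binary projections; this is the action of \<open>t\<close> there.\<close>

definition pattern :: "'a \<Rightarrow> 'a \<times> 'a \<times> 'a" where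
  "pattern t = (composition C 3 2 t [p, p, q], composition C 3 2 t [p, q, p],
     composition C 3 2 t [q, p, p])"

lemma majority_iff_pattern: "majority_operation C t \<longleftrightarrow> t \<in> ops C 3 \<and> pattern t = (p, p, p)"
  by (simp add: majority_operation_def pattern_def)

lemma pattern_projections: "pattern x = (p, p, q)" "pattern y = (p, q, p)" "pattern z = (q, p, p)"
  by (simp_all add: pattern_def comp_3_proj)

lemma pattern_comp:
  assumes "t \<in> ops C 3" "a \<in> ops C 3" "b \<in> ops C 3" "c \<in> ops C 3"
    "pattern a = (a1, a2, a3)" "pattern b = (b1, b2, b3)" "pattern c = (c1, c2, c3)"
  shows "pattern (ternary_comp C t a b c) = (composition C 3 2 t [a1, b1, c1],
    composition C 3 2 t [a2, b2, c2], composition C 3 2 t [a3, b3, c3])"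
  using assms by (auto simp: pattern_def comp_assoc_3[of t _ 3])

lemma generated_ternary_subset:
  assumes "t \<in> ops C 3" "t \<notin> projections C 3" "x \<in> S" "y \<in> S" "z \<in> S" "S \<subseteq> ops C 3"
    and closed: "\<And>a b c. a \<in> S \<Longrightarrow> b \<in> S \<Longrightarrow> c \<in> S \<Longrightarrow> ternary_comp C t a b c \<in> S"
  shows "ops C 3 \<subseteq> S"
proof -
  have "ops (generated_clone C 3 t) 3 \<subseteq> S"
  proof (rule generated_ops_subset)
    fix i :: nat assume "i \<in> {1..3}"
    then have "i = Suc 0 \<or> i = 2 \<or> i = 3" by auto
    then show "proj C 3 i \<in> S" using assms by auto
  qed (use assms in \<open>auto simp: length_3_conv\<close>)
  then show ?thesis using assms by (simp add: nontrivial_generates)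
qed

text \<open>\<open>f\<close> acts on patterns as componentwise majority, and these four triples are
  closed under it.\<close>

lemma pattern_cases:
  assumes "t \<in> ops C 3"
  shows "pattern t \<in> {(p, p, q), (p, q, p), (q, p, p), (p, p, p)}"
proof -
  let ?P = "{(p, p, q), (p, q, p), (q, p, p), (p, p, p)}"
  have "ops C 3 \<subseteq> {t \<in> ops C 3. pattern t \<in> ?P}"
  proof (rule generated_ternary_subset[OF f_closed f_nontrivial])
    fix a b c
    assume "a \<in> {t \<in> ops C 3. pattern t \<in> ?P}" "b \<in> {t \<in> ops C 3. pattern t \<in> ?P}"
      "c \<in> {t \<in> ops C 3. pattern t \<in> ?P}"
    then have abc: "a \<in> ops C 3" "b \<in> ops C 3" "c \<in> ops C 3"
      and P: "pattern a \<in> ?P" "pattern b \<in> ?P" "pattern c \<in> ?P" by auto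
    note comp = pattern_comp[OF f_closed abc]
    have "pattern (ternary_comp C f a b c) \<in> ?P"
      using P
      by (elim insertE emptyE; simp add: comp majority_operation_idem[OF f_majority])
    then show "ternary_comp C f a b c \<in> {t \<in> ops C 3. pattern t \<in> ?P}"
      using abc by (simp add: comp_3_closed f_closed)
  qed (simp_all add: pattern_projections)
  then show ?thesis using assms by blast
qed

text \<open>Otherwise \<open>t\<close> acts on \<open>p\<close> and \<open>q\<close> as a
  projection, so all it generates has the pattern of a projection. By minimality this would include
  \<open>f\<close>.\<close>

lemma nontrivial_majority:
  assumes t: "t \<in> ops C 3" "t \<notin> projections C 3"
  shows "majority_operation C t"
proof (rule ccontr)
  assume "\<not> ?thesis"
  then have pat: "pattern t \<in> {(p, p, q), (p, q, p), (q, p, p)}"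
    using pattern_cases[OF t(1)] t(1) by (simp add: majority_iff_pattern)
  have swap: "composition C 3 2 t [composition C 2 2 u [v, w], composition C 2 2 u' [v, w],
      composition C 2 2 u'' [v, w]] = composition C 2 2 (composition C 3 2 t [u, u', u'']) [v, w]"
    if "u \<in> ops C 2" "u' \<in> ops C 2" "u'' \<in> ops C 2" "v \<in> ops C 2" "w \<in> ops C 2"
    for u u' u'' v w
    using that t by (simp add: comp_assoc_3)
  \<comment> \<open>Exchanging or identifying \<open>p\<close> and \<open>q\<close> extends the
    three values in the pattern of \<open>t\<close> to all arguments among \<open>p\<close> and
    \<open>q\<close>.\<close>
  note t_pq = swap[of p p q q p] swap[of p q p q p] swap[of q p p q p] swap[of p p q p p]
    swap[of p p q q q]
  let ?P = "{(p, p, q), (p, q, p), (q, p, p)}"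
  have "ops C 3 \<subseteq> {t \<in> ops C 3. pattern t \<in> ?P}"
  proof (rule generated_ternary_subset[OF t])
    fix a b c
    assume "a \<in> {t \<in> ops C 3. pattern t \<in> ?P}" "b \<in> {t \<in> ops C 3. pattern t \<in> ?P}"
      "c \<in> {t \<in> ops C 3. pattern t \<in> ?P}"
    then have abc: "a \<in> ops C 3" "b \<in> ops C 3" "c \<in> ops C 3"
      and P: "pattern a \<in> ?P" "pattern b \<in> ?P" "pattern c \<in> ?P" by auto
    note comp = pattern_comp[OF t(1) abc]
    have "pattern (ternary_comp C t a b c) \<in> {pattern a, pattern b, pattern c}"
      using P pat t_pq
      by (elim insertE emptyE; simp add: comp comp_2_proj; simp add: pattern_def comp_2_proj)
    then show "ternary_comp C t a b c \<in> {t \<in> ops C 3. pattern t \<in> ?P}"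
      using abc P t by (auto simp: comp_3_closed)
  qed (simp_all add: pattern_projections)
  then have "pattern f \<in> ?P" using f_closed by blast
  then show False using f_majority pq by (auto simp: majority_iff_pattern)
qed

end

lemma (in majority_generated_clone) minimal_ternary_part:
  assumes "finite (ops C 3)" "card (ops C 3) \<le> 7"
  shows "minimal_ternary_part (ops C 3) {t. majority_operation C t} (ternary_comp C) x y z"
proof
  let ?M = "{t. majority_operation C t}"
  have M_ops: "t \<in> ops C 3" if "t \<in> ?M" for t
    using that by (simp add: majority_operation_def)
  have xyz: "x \<notin> ?M" "y \<notin> ?M" "z \<notin> ?M"
    using pq by (auto simp: majority_iff_pattern pattern_projections)
  have split: "ops C 3 = {x, y, z} \<union> ?M"
    using nontrivial_majority M_ops unfolding projections_3 by auto
  have distinct: "distinct [x, y, z]"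
    using pq by (auto dest!: arg_cong[of _ _ pattern] simp: pattern_projections)
  then show "x \<noteq> y" "y \<noteq> z" "x \<noteq> z" "y \<noteq> x" "z \<noteq> y" "z \<noteq> x" by auto
  show "x \<notin> ?M" "y \<notin> ?M" "z \<notin> ?M" by (rule xyz)+
  show "finite ?M" using assms(1) by (rule finite_subset[rotated]) (use M_ops in blast)
  have "card (ops C 3) = card {x, y, z} + card ?M"
    unfolding split using xyz \<open>finite ?M\<close> by (intro card_Un_disjoint) auto
  then show "card ?M \<le> 4" using assms(2) distinct by simp
  show "?M \<noteq> {}" using f_majority by auto
  show "ternary_comp C t a b c \<in> ?M"
    if t: "t \<in> ?M" and abc: "a \<in> ops C 3" "b \<in> ops C 3" "c \<in> ops C 3" "a \<noteq> b" "b \<noteq> c" "a \<noteq> c"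
    for t a b c
  proof -
    have pat: "u = x \<or> u = y \<or> u = z \<or> pattern u = (p, p, p)" if "u \<in> ops C 3" for u
      using nontrivial_majority[OF that] projections_3 unfolding majority_iff_pattern by blast
    \<comment> \<open>Distinct operations share a pattern only if both are majority operations.
      Hence in each coordinate at most one of \<open>a\<close>, \<open>b\<close>, \<open>c\<close>
      contributes \<open>q\<close>.\<close>
    have inj: "pattern u \<noteq> pattern w \<or> pattern u = (p, p, p)"
      if "u \<in> ops C 3" "w \<in> ops C 3" "u \<noteq> w" for u w
      using pat[OF that(1)] pat[OF that(2)] \<open>u \<noteq> w\<close> pq
      by (elim disjE; simp add: pattern_projections)
    note comp = pattern_comp[OF M_ops[OF t] abc(1-3)]
    have maj: "majority_operation C t" using t by simp
    have "pattern (ternary_comp C t a b c) = (p, p, p)"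
      using pattern_cases[OF abc(1)] pattern_cases[OF abc(2)] pattern_cases[OF abc(3)]
        inj[OF abc(1,2,4)] inj[OF abc(2,3,5)] inj[OF abc(1,3,6)]
      by (elim insertE emptyE; simp add: comp majority_operation_idem[OF maj])
    then show ?thesis using abc M_ops[OF t] by (simp add: majority_iff_pattern comp_3_closed)
  qed
  show "t \<in> ops C 3" if "t \<in> ?M" for t using that by (rule M_ops)
  show "?M \<subseteq> S" if t: "t \<in> ?M" and "x \<in> S" "y \<in> S" "z \<in> S"
    and closed: "\<And>a b c. \<lbrakk>a \<in> S; b \<in> S; c \<in> S\<rbrakk> \<Longrightarrow> ternary_comp C t a b c \<in> S" for t S
  proof -
    have "t \<notin> projections C 3" using t xyz projections_3 by auto
    then have "ops C 3 \<subseteq> S \<inter> ops C 3"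
      using that M_ops[OF t] by (intro generated_ternary_subset[of t]) (auto simp: comp_3_closed)
    then show ?thesis using M_ops by blast
  qed
  show "ternary_comp C (ternary_comp C t a b c) u v w =
      ternary_comp C t (ternary_comp C a u v w) (ternary_comp C b u v w) (ternary_comp C c u v w)"
    if "t \<in> ops C 3" "a \<in> ops C 3" "b \<in> ops C 3" "c \<in> ops C 3" "u \<in> ops C 3" "v \<in> ops C 3"
      "w \<in> ops C 3" for t a b c u v w
    using that by (intro comp_assoc_3) auto
qed (simp_all add: comp_3_closed comp_3_proj comp_3_proj_right majority_operation_idem)

section \<open>Comparison of two clones through their labelled ternary terms\<close>

lemma m1_isomorphic:
  assumes C: "abstract_clone C" "f \<in> ops C 3" "m1_algebra (ops C 3) (ternary_comp C f)"
      "distinct [proj C 3 1, proj C 3 2, proj C 3 3, f]"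
    and D: "abstract_clone D" "g \<in> ops D 3" "m1_algebra (ops D 3) (ternary_comp D g)"
      "distinct [proj D 3 1, proj D 3 2, proj D 3 3, g]"
  shows "ternary_parts_isomorphic (generated_clone C 3 f) (generated_clone D 3 g)"
proof -
  interpret C: abstract_clone C by fact
  interpret D: abstract_clone D by fact
  have cp: "proj C 3 1 \<in> ops C 3" "proj C 3 2 \<in> ops C 3" "proj C 3 3 \<in> ops C 3"
    by (simp_all add: C.proj_3_closed)
  have dp: "proj D 3 1 \<in> ops D 3" "proj D 3 2 \<in> ops D 3" "proj D 3 3 \<in> ops D 3"
    by (simp_all add: D.proj_3_closed)
  let ?L = "{0, 1, 2, 3} :: nat set"
  let ?v = "m1_term (ternary_comp C f) (proj C 3 1) (proj C 3 2) (proj C 3 3)"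
  let ?w = "m1_term (ternary_comp D g) (proj D 3 1) (proj D 3 2) (proj D 3 3)"
  let ?\<mu> = "majority_extension (\<lambda>_ _ _. 0) :: nat \<Rightarrow> nat \<Rightarrow> nat \<Rightarrow> nat"
  have v: "?v 0 = f" "?v 1 = proj C 3 1" "?v 2 = proj C 3 2" "?v 3 = proj C 3 3"
    using C(2) by (simp_all add: m1_term_def C.comp_3_proj_right)
  have w: "?w 0 = g" "?w 1 = proj D 3 1" "?w 2 = proj D 3 2" "?w 3 = proj D 3 3"
    using D(2) by (simp_all add: m1_term_def D.comp_3_proj_right)
  show ?thesis
  proof (rule ternary_parts_isomorphicI[OF C(1,2) D(1,2), where L = ?L and v = ?v and w = ?w
        and \<mu> = ?\<mu> and p = id])
    show "inj_on ?v ?L" using C(4) unfolding inj_on_def by (simp only: ball_simps v) auto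
    show "inj_on ?w ?L" using D(4) unfolding inj_on_def by (simp only: ball_simps w) auto
    show "id i \<in> ?L \<and> ?v (id i) = proj C 3 i \<and> ?w (id i) = proj D 3 i" if "i \<in> {1..3}" for i
    proof -
      have "i = 1 \<or> i = 2 \<or> i = 3" using that by auto
      then show ?thesis using v w by auto
    qed
    show "?\<mu> a b c \<in> ?L \<and> ternary_comp C f (?v a) (?v b) (?v c) = ?v (?\<mu> a b c) \<and>
      ternary_comp D g (?w a) (?w b) (?w c) = ?w (?\<mu> a b c)"
      if "a \<in> ?L" "b \<in> ?L" "c \<in> ?L" for a b c
    proof (intro conjI)
      show "?\<mu> a b c \<in> ?L" using that by (simp add: majority_extension_def)
      show "ternary_comp C f (?v a) (?v b) (?v c) = ?v (?\<mu> a b c)"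
        by (rule m1_algebra.m1_table[OF C(3)]) (fact that cp)+
      show "ternary_comp D g (?w a) (?w b) (?w c) = ?w (?\<mu> a b c)"
        by (rule m1_algebra.m1_table[OF D(3)]) (fact that dp)+
    qed
    show "?L \<subseteq> S" if "\<And>i. i \<in> {1..3} \<Longrightarrow> id i \<in> S"
      "\<And>a b c. \<lbrakk>a \<in> S; b \<in> S; c \<in> S\<rbrakk> \<Longrightarrow> ?\<mu> a b c \<in> S" for S
    proof -
      have "1 \<in> S" "2 \<in> S" "3 \<in> S" using that(1)[of 1] that(1)[of 2] that(1)[of 3] by simp_all
      moreover from this have "0 \<in> S" using that(2)[of 1 2 3] by (simp add: majority_extension_def)
      ultimately show ?thesis by simp
    qed
  qed
qed

lemma m2_isomorphic:
  assumes C: "abstract_clone C" "f \<in> ops C 3" "m2_algebra (ops C 3) (ternary_comp C f)"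
      "distinct [proj C 3 1, proj C 3 2, proj C 3 3, f,
         ternary_comp C f (proj C 3 2) (proj C 3 1) (proj C 3 3),
         ternary_comp C f (proj C 3 3) (proj C 3 1) (proj C 3 2)]"
    and D: "abstract_clone D" "g \<in> ops D 3" "m2_algebra (ops D 3) (ternary_comp D g)"
      "distinct [proj D 3 1, proj D 3 2, proj D 3 3, g,
         ternary_comp D g (proj D 3 2) (proj D 3 1) (proj D 3 3),
         ternary_comp D g (proj D 3 3) (proj D 3 1) (proj D 3 2)]"
  shows "ternary_parts_isomorphic (generated_clone C 3 f) (generated_clone D 3 g)"
proof -
  interpret C: abstract_clone C by fact
  interpret D: abstract_clone D by fact
  have cp: "proj C 3 1 \<in> ops C 3" "proj C 3 2 \<in> ops C 3" "proj C 3 3 \<in> ops C 3"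
    by (simp_all add: C.proj_3_closed)
  have dp: "proj D 3 1 \<in> ops D 3" "proj D 3 2 \<in> ops D 3" "proj D 3 3 \<in> ops D 3"
    by (simp_all add: D.proj_3_closed)
  let ?L = "{1, 2, 3} \<times> UNIV :: (nat \<times> bool) set"
  let ?v = "m2_term (ternary_comp C f) (proj C 3 1) (proj C 3 2) (proj C 3 3)"
  let ?w = "m2_term (ternary_comp D g) (proj D 3 1) (proj D 3 2) (proj D 3 3)"
  have L: "?L = {(1, False), (2, False), (3, False), (1, True), (2, True), (3, True)}"
    by (auto simp: UNIV_bool)
  have v: "?v (1, False) = proj C 3 1" "?v (2, False) = proj C 3 2" "?v (3, False) = proj C 3 3"
    "?v (1, True) = f" "?v (2, True) = ternary_comp C f (proj C 3 2) (proj C 3 1) (proj C 3 3)"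
    "?v (3, True) = ternary_comp C f (proj C 3 3) (proj C 3 1) (proj C 3 2)"
    using C(2) by (simp_all add: m2_term_def C.comp_3_proj_right)
  have w: "?w (1, False) = proj D 3 1" "?w (2, False) = proj D 3 2" "?w (3, False) = proj D 3 3"
    "?w (1, True) = g" "?w (2, True) = ternary_comp D g (proj D 3 2) (proj D 3 1) (proj D 3 3)"
    "?w (3, True) = ternary_comp D g (proj D 3 3) (proj D 3 1) (proj D 3 2)"
    using D(2) by (simp_all add: m2_term_def D.comp_3_proj_right)
  show ?thesis
  proof (rule ternary_parts_isomorphicI[OF C(1,2) D(1,2), where L = ?L and v = ?v and w = ?w
        and \<mu> = m2_label and p = "\<lambda>i. (i, False)"])
    show "inj_on ?v ?L" using C(4) unfolding inj_on_def L by (simp only: ball_simps v) auto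
    show "inj_on ?w ?L" using D(4) unfolding inj_on_def L by (simp only: ball_simps w) auto
    show "(i, False) \<in> ?L \<and> ?v (i, False) = proj C 3 i \<and> ?w (i, False) = proj D 3 i"
      if "i \<in> {1..3}" for i
    proof -
      have "i = 1 \<or> i = 2 \<or> i = 3" using that by auto
      then show ?thesis using v w by auto
    qed
    show "m2_label a b c \<in> ?L \<and> ternary_comp C f (?v a) (?v b) (?v c) = ?v (m2_label a b c) \<and>
      ternary_comp D g (?w a) (?w b) (?w c) = ?w (m2_label a b c)"
      if "a \<in> ?L" "b \<in> ?L" "c \<in> ?L" for a b c
    proof (intro conjI)
      show "m2_label a b c \<in> ?L" using that by (rule m2_label_closed)
      show "ternary_comp C f (?v a) (?v b) (?v c) = ?v (m2_label a b c)"
        by (rule m2_algebra.m2_table[OF C(3)]) (fact that cp)+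
      show "ternary_comp D g (?w a) (?w b) (?w c) = ?w (m2_label a b c)"
        by (rule m2_algebra.m2_table[OF D(3)]) (fact that dp)+
    qed
    show "?L \<subseteq> S" if "\<And>i. i \<in> {1..3} \<Longrightarrow> (i, False) \<in> S"
      "\<And>a b c. \<lbrakk>a \<in> S; b \<in> S; c \<in> S\<rbrakk> \<Longrightarrow> m2_label a b c \<in> S" for S
    proof -
      have S: "(1, False) \<in> S" "(2, False) \<in> S" "(3, False) \<in> S"
        using that(1)[of 1] that(1)[of 2] that(1)[of 3] by simp_all
      have "(1, True) \<in> S" "(2, True) \<in> S" "(3, True) \<in> S"
        using that(2)[OF S(1,2,3)] that(2)[OF S(2,1,3)] that(2)[OF S(3,1,2)]
        by (simp_all add: m2_label_def majority_extension_def)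
      then show ?thesis using S unfolding L by simp
    qed
  qed
qed

section \<open>The clones \<open>[m\<^sub>1]\<close> and \<open>[m\<^sub>2]\<close>\<close>

lemma full_clone_3:
  "ops (full_clone A) 3 = tuples A 3 \<rightarrow>\<^sub>E A"
  "proj (full_clone A) 3 i = (\<lambda>xs\<in>tuples A 3. xs ! (i - 1))"
  "ternary_comp (full_clone A) t a b c = (\<lambda>xs\<in>tuples A 3. t [a xs, b xs, c xs])"
  by (simp_all add: full_clone_def)

text \<open>Composition is pointwise, so identities of \<open>d\<close> on \<open>A\<close> pass to
  ternary operations.\<close>

lemma m1_algebra_full_clone:
  assumes g: "g \<in> ops (full_clone A) 3" "\<And>a b c. \<lbrakk>a \<in> A; b \<in> A; c \<in> A\<rbrakk> \<Longrightarrow> g [a, b, c] = d a b c"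
    and d: "m1_algebra A d"
  shows "m1_algebra (ops (full_clone A) 3) (ternary_comp (full_clone A) g)"
proof -
  interpret m1_algebra A d by fact
  interpret E: abstract_clone "full_clone A" by (rule abstract_clone_full_clone)
  have mem: "a xs \<in> A" if "a \<in> ops (full_clone A) 3" "xs \<in> tuples A 3" for a xs
    using that unfolding full_clone_3 by (rule PiE_mem)
  have ext: "ternary_comp (full_clone A) g a b c = e"
    if abc: "a \<in> ops (full_clone A) 3" "b \<in> ops (full_clone A) 3" "c \<in> ops (full_clone A) 3"
      "e \<in> ops (full_clone A) 3" and e: "\<And>xs. xs \<in> tuples A 3 \<Longrightarrow> d (a xs) (b xs) (c xs) = e xs" for a b c e
  proof (rule extensionalityI)
    show "e \<in> extensional (tuples A 3)" using abc(4) by (simp add: full_clone_3(1) PiE_iff)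
    show "ternary_comp (full_clone A) g a b c xs = e xs" if xs: "xs \<in> tuples A 3" for xs
      using abc xs mem e
      by (simp add: full_clone_3(3) g)
  qed (simp add: full_clone_3(3))
  have app: "ternary_comp (full_clone A) g a b c xs = d (a xs) (b xs) (c xs)"
    if "a \<in> ops (full_clone A) 3" "b \<in> ops (full_clone A) 3" "c \<in> ops (full_clone A) 3"
      "xs \<in> tuples A 3" for a b c xs
    using that by (simp add: full_clone_3(3) g mem)
  note simps = mem app E.comp_3_closed g(1)
  show ?thesis
    by unfold_locales
      (simp_all add: E.comp_3_closed g(1), (rule ext; simp add: simps majority symmetric absorb)+)
qed

lemma m2_algebra_full_clone:
  assumes g: "g \<in> ops (full_clone A) 3" "\<And>a b c. \<lbrakk>a \<in> A; b \<in> A; c \<in> A\<rbrakk> \<Longrightarrow> g [a, b, c] = d a b c"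
    and d: "m2_algebra A d"
  shows "m2_algebra (ops (full_clone A) 3) (ternary_comp (full_clone A) g)"
proof -
  interpret m2_algebra A d by fact
  interpret E: abstract_clone "full_clone A" by (rule abstract_clone_full_clone)
  have mem: "a xs \<in> A" if "a \<in> ops (full_clone A) 3" "xs \<in> tuples A 3" for a xs
    using that unfolding full_clone_3 by (rule PiE_mem)
  have ext: "ternary_comp (full_clone A) g a b c = e"
    if abc: "a \<in> ops (full_clone A) 3" "b \<in> ops (full_clone A) 3" "c \<in> ops (full_clone A) 3"
      "e \<in> ops (full_clone A) 3" and e: "\<And>xs. xs \<in> tuples A 3 \<Longrightarrow> d (a xs) (b xs) (c xs) = e xs" for a b c e
  proof (rule extensionalityI)
    show "e \<in> extensional (tuples A 3)" using abc(4) by (simp add: full_clone_3(1) PiE_iff)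
    show "ternary_comp (full_clone A) g a b c xs = e xs" if xs: "xs \<in> tuples A 3" for xs
      using abc xs mem e
      by (simp add: full_clone_3(3) g)
  qed (simp add: full_clone_3(3))
  have app: "ternary_comp (full_clone A) g a b c xs = d (a xs) (b xs) (c xs)"
    if "a \<in> ops (full_clone A) 3" "b \<in> ops (full_clone A) 3" "c \<in> ops (full_clone A) 3"
      "xs \<in> tuples A 3" for a b c xs
    using that by (simp add: full_clone_3(3) g mem)
  note simps = mem app E.comp_3_closed g(1)
  show ?thesis
    by unfold_locales
      (simp_all add: E.comp_3_closed g(1),
        (rule ext; simp add: simps majority symmetric absorb_121 absorb_123)+)
qed

lemma m1_algebra_m1:
  "m1_algebra (ops (full_clone {1, 2, 3}) 3) (ternary_comp (full_clone {1, 2, 3}) m1)"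
proof (rule m1_algebra_full_clone)
  show "m1 \<in> ops (full_clone {1, 2, 3}) 3"
    using majority_operation_m1 by (simp add: majority_operation_def)
  show "m1 [a, b, c] = majority_extension (\<lambda>_ _ _. 1) a b c"
    if "a \<in> {1, 2, 3}" "b \<in> {1, 2, 3}" "c \<in> {1, 2, 3}" for a b c
    using that by (simp add: m1_def tuples_def)
  show "m1_algebra {1, 2, 3 :: nat} (majority_extension (\<lambda>_ _ _. 1))"
    by unfold_locales (auto simp: majority_extension_def)
qed

lemma m2_algebra_m2:
  "m2_algebra (ops (full_clone {1, 2, 3}) 3) (ternary_comp (full_clone {1, 2, 3}) m2)"
proof (rule m2_algebra_full_clone)
  show "m2 \<in> ops (full_clone {1, 2, 3}) 3"
    using majority_operation_m2 by (simp add: majority_operation_def)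
  show "m2 [a, b, c] = majority_extension (\<lambda>a _ _. a) a b c"
    if "a \<in> {1, 2, 3}" "b \<in> {1, 2, 3}" "c \<in> {1, 2, 3}" for a b c
    using that by (simp add: m2_def tuples_def)
  show "m2_algebra {1, 2, 3 :: nat} (majority_extension (\<lambda>a _ _. a))"
    by unfold_locales (auto simp: majority_extension_def)
qed

text \<open>On these four triples the three projections and the three variants of \<^const>\<open>m2\<close> all differ.\<close>

definition samples :: "nat list list" where
  "samples = [[1, 1, 2], [1, 2, 1], [2, 1, 1], [1, 2, 3]]"

lemma distinct_m1:
  "distinct [proj (full_clone {1, 2, 3}) 3 1, proj (full_clone {1, 2, 3}) 3 2,
     proj (full_clone {1, 2, 3}) 3 3, m1]" (is "distinct ?ts")
proof -
  have "distinct (map (\<lambda>t. map t samples) ?ts)"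
    by (simp add: samples_def full_clone_3 tuples_def m1_def majority_extension_def)
  then show ?thesis unfolding distinct_map by blast
qed

lemma distinct_m2:
  "distinct [proj (full_clone {1, 2, 3}) 3 1, proj (full_clone {1, 2, 3}) 3 2,
     proj (full_clone {1, 2, 3}) 3 3, m2,
     ternary_comp (full_clone {1, 2, 3}) m2 (proj (full_clone {1, 2, 3}) 3 2)
       (proj (full_clone {1, 2, 3}) 3 1) (proj (full_clone {1, 2, 3}) 3 3),
     ternary_comp (full_clone {1, 2, 3}) m2 (proj (full_clone {1, 2, 3}) 3 3)
       (proj (full_clone {1, 2, 3}) 3 1) (proj (full_clone {1, 2, 3}) 3 2)]" (is "distinct ?ts")
proof -
  have "distinct (map (\<lambda>t. map t samples) ?ts)"
    by (simp add: samples_def full_clone_3 tuples_def m2_def majority_extension_def)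
  then show ?thesis unfolding distinct_map by blast
qed

text \<open>Finiteness is stated apart from the bound because \<open>card\<close> is 0 on infinite
  sets.\<close>

theorem theorem4p1:
  fixes C :: "'a clone"
  assumes "majority_minimal_clone C"
    and "finite (ops C 3)" and "card (ops C 3) \<le> 7"
  shows "ternary_parts_isomorphic C (generated_clone (full_clone {1, 2, 3}) 3 m1) \<or>
         ternary_parts_isomorphic C (generated_clone (full_clone {1, 2, 3}) 3 m2)"
proof -
  obtain f\<^sub>0 where C: "abstract_clone C" "majority_operation C f\<^sub>0" "generated_clone C 3 f\<^sub>0 = C"
      "minimal_clone C"
    using assms(1) unfolding majority_minimal_clone_def majority_clone_def by metis
  interpret abstract_clone C by fact
  interpret majority_generated_clone C f\<^sub>0 by unfold_locales fact+
  interpret minimal_ternary_part "ops C 3" "{t. majority_operation C t}" "ternary_comp C" x y z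
    using assms(2,3) by (rule minimal_ternary_part)
  let ?m1 = "m1_algebra (ops C 3)" and ?m2 = "m2_algebra (ops C 3)"
  obtain f where f: "majority_operation C f" and cases: "?m1 (ternary_comp C f) \<or>
      ?m2 (ternary_comp C f) \<and> distinct [f, ternary_comp C f y x z, ternary_comp C f z x y]"
    using m1_or_m2 by auto
  have f_ops: "f \<in> ops C 3" using f by simp
  \<comment> \<open>The operation supplied by \<open>m1_or_m2\<close> may differ from the given
    generator, but by minimality it generates \<open>C\<close> too.\<close>
  have f_gen: "generated_clone C 3 f = C"
    using nontrivial_generates[OF f_ops] M_not_gen[of f] f projections_3 by auto
  have E: "m1 \<in> ops (full_clone {1, 2, 3}) 3" "m2 \<in> ops (full_clone {1, 2, 3}) 3"
    using majority_operation_m1 majority_operation_m2 by (simp_all add: majority_operation_def)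
  from cases show ?thesis
  proof
    assume "?m1 (ternary_comp C f)"
    then have "ternary_parts_isomorphic (generated_clone C 3 f)
        (generated_clone (full_clone {1, 2, 3}) 3 m1)"
    proof (rule m1_isomorphic[OF C(1) f_ops])
      show "distinct [proj C 3 1, proj C 3 2, proj C 3 3, f]"
        using M_not_gen[of f] f by simp
    qed (fact abstract_clone_full_clone E m1_algebra_m1 distinct_m1)+
    then show ?thesis by (simp add: f_gen)
  next
    assume m2: "?m2 (ternary_comp C f) \<and>
      distinct [f, ternary_comp C f y x z, ternary_comp C f z x y]"
    then have "ternary_parts_isomorphic (generated_clone C 3 f)
        (generated_clone (full_clone {1, 2, 3}) 3 m2)"
    proof (intro m2_isomorphic[OF C(1) f_ops])
      have "ternary_comp C f y x z \<in> {t. majority_operation C t}"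
        "ternary_comp C f z x y \<in> {t. majority_operation C t}"
        by (intro ap_in_M; use f in simp)+
      then show "distinct [proj C 3 1, proj C 3 2, proj C 3 3, f,
          ternary_comp C f (proj C 3 2) (proj C 3 1) (proj C 3 3),
          ternary_comp C f (proj C 3 3) (proj C 3 1) (proj C 3 2)]"
        using m2 M_not_gen[of f] M_not_gen[of "ternary_comp C f y x z"]
          M_not_gen[of "ternary_comp C f z x y"] f by simp
    qed (simp_all only: abstract_clone_full_clone E m2_algebra_m2 distinct_m2)
    then show ?thesis by (simp add: f_gen)
  qed
qed

end
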